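(* Let $G$ be a finite group and let $X$ be a real algebraic $G$-variety of dimension $d$. Then for all $p\in\mathbb{Z}$, $${}^G\!\widetilde{E}^2_{p,d}(X) = H^{-p}\left(G,\widetilde{E}^2_{0,d}(X)\right).$$
   Context: **Varieties and chains.** A real algebraic variety is a reduced separated scheme of finite type over $\mathbb{R}$; a real algebraic $G$-variety carries an action of $G$ by scheme isomorphisms such that every orbit lies in an affine open subscheme. $C_*(X)$ is the complex of semialgebraic chains with closed supports and $\mathbb{Z}_2$-coefficients of the real points $X_{\mathbb{R}}$: $C_k(X)$ is generated by closed semialgebraic subsets of $X_{\mathbb{R}}$ of dimension $\le k$ modulo $A+B\sim\overline{A\div B}$ and $A\sim0$ if $\dim A<k$, with the semialgebraic boundary. $G$ acts on it by functoriality. **Weight complex with action.** $\mathcal{W}C_*(X)$ is the weight complex with action of $X$: a bounded complex of $\mathbb{Z}_2$-vector spaces with $G$-action and bounded increasing $G$-stable filtration, well-defined up to equivariant filtered quasi-isomorphism (equivariant filtered morphisms inducing isomorphisms on $E^1$). It is represented by the Nash-constructible filtration $\mathcal{N}C_*(X)$ (with the induced $G$-action), which may be taken as its definition: for $-k\le p\le 0$, $c\in\mathcal{N}_pC_k(X)$ iff there is a function $\varphi:X_{\mathbb{R}}\to 2^{k+p}\mathbb{Z}$ which coincides with a Nash-constructible function outside a semialgebraic subset of dimension $<k$ and such that $c=[\{x:\varphi(x)\notin 2^{k+p+1}\mathbb{Z}\}]$ up to a set of dimension $<k$; $\mathcal{N}_pC_k=0$ for $p<-k$ and $\mathcal{N}_pC_k=C_k$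 for $p\ge0$. Here a function on the real points of a complete variety $\overline X$ is Nash-constructible if it is of the form $x\mapsto\sum_i m_i\,\chi(f_i^{-1}(x)\cap Z_i')$ (finite sum, $m_i\in\mathbb{Z}$, $f_i:Z_i\to\overline X$ proper regular, $Z_i'$ a connected component of the real points of $Z_i$), and on a general $X$ it is the restriction of such a function on a compactification $\overline X$. **Spectral sequences.** For a filtered complex $(K_*,F)$, $E^0_{p,q}=F_pK_{p+q}/F_{p-1}K_{p+q}$. The weight spectral sequence $E^r_{p,q}(X)$ is the spectral sequence of $\mathcal{W}C_*(X)$ (with induced $G$-action); it is reindexed by $p'=2p+q$, $q'=-p$, $r'=r+1$, giving $\widetilde{E}^{r'}_{p',q'}$. **Group (co)homology and equivariant weight complex.** $H^n(G,M)=\mathrm{Ext}^n_{\mathbb{Z}[G]}(\mathbb{Z},M)$ ($=0$ for $n<0$). Fix a projective resolution $F_*$ of $\mathbb{Z}$ over $\mathbb{Z}[G]$. For a bounded $G$-complex $K_*$ of $\mathbb{Z}_2$-vector spaces, $L_*(K_* )$ is the total complex of $(\mathrm{Hom}_G(F_{-p},K_q))_{p,q}$; if $K_*$ is filtered by $J$, then $L_*(K_* )$ is filtered by $\mathcal{J}_\alpha L_k(K_* )=L_k(J_\alpha K_* )$. The equivariant weight complex is $\Omega C^G_*(X)=L_*(\mathcal{W}C_*(X))$; its spectral sequence, reindexed in the same way, is the equivariant weight spectral sequence ${}^G\!\widetilde{E}^{r}_{p,q}(X)$. The equality in the claim is a (canonical) isomorphism of $\mathbb{Z}_2$-vector spaces.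 *)

theory Defs
  imports
    "HOL-Analysis.Analysis"
    "HOL-Algebra.Ideal"
    "HOL-Algebra.Generated_Rings"
    "HOL-Algebra.Product_Groups"
    "HOL-Homology.Homology"
begin

section \<open>Schemes over the reals\<close>

text \<open>
  A space with a sheaf of commutative \<open>\<real>\<close>-algebras. \<open>restr X U V\<close> is the restriction from \<open>U\<close> to
  \<open>V \<subseteq> U\<close>, and \<open>const_sec X U\<close> is the structure map from \<open>\<real>\<close> to the sections over \<open>U\<close>; giving
  these maps is the same as giving a morphism to \<open>Spec \<real>\<close>. Values at non-open sets are irrelevant.
\<close>

record ('p, 's) rspace =
  zariski :: "'p topology"
  sections :: "'p set \<Rightarrow> 's ring"
  restr :: "'p set \<Rightarrow> 'p set \<Rightarrow> 's \<Rightarrow> 's"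
  const_sec :: "'p set \<Rightarrow> real \<Rightarrow> 's"

abbreviation points :: "('p, 's) rspace \<Rightarrow> 'p set" where
  "points X \<equiv> topspace (zariski X)"

definition real_ring :: "real ring" where
  "real_ring = \<lparr>carrier = UNIV, monoid.mult = (*), one = 1, ring.zero = 0, add = (+)\<rparr>"

definition sheaf_of_algebras :: "('p, 's) rspace \<Rightarrow> bool" where
  "sheaf_of_algebras X \<longleftrightarrow>
     (\<forall>U. openin (zariski X) U \<longrightarrow>
        cring (sections X U) \<and> const_sec X U \<in> ring_hom real_ring (sections X U)) \<and>
     (\<forall>U V. openin (zariski X) U \<and> openin (zariski X) V \<and> V \<subseteq> U \<longrightarrow>
        restr X U V \<in> ring_hom (sections X U) (sections X V) \<and>
        (\<forall>r. restr X U V (const_sec X U r) = const_sec X V r)) \<and>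
     (\<forall>U. openin (zariski X) U \<longrightarrow> (\<forall>s\<in>carrier (sections X U). restr X U U s = s)) \<and>
     (\<forall>U V W. openin (zariski X) U \<and> openin (zariski X) V \<and> openin (zariski X) W \<and>
        W \<subseteq> V \<and> V \<subseteq> U \<longrightarrow>
        (\<forall>s\<in>carrier (sections X U). restr X V W (restr X U V s) = restr X U W s)) \<and>
     (\<forall>\<U> t. (\<forall>U\<in>\<U>. openin (zariski X) U \<and> t U \<in> carrier (sections X U)) \<and>
        (\<forall>U\<in>\<U>. \<forall>V\<in>\<U>. restr X U (U \<inter> V) (t U) = restr X V (U \<inter> V) (t V)) \<longrightarrow>
        (\<exists>!s. s \<in> carrier (sections X (\<Union>\<U>)) \<and> (\<forall>U\<in>\<U>. restr X (\<Union>\<U>) U s = t U)))"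

text \<open>The germ at \<open>x\<close> of the section \<open>s\<close> over \<open>U\<close> is a unit of the stalk.\<close>

definition unit_at :: "('p, 's) rspace \<Rightarrow> 'p set \<Rightarrow> 's \<Rightarrow> 'p \<Rightarrow> bool" where
  "unit_at X U s x \<longleftrightarrow>
     (\<exists>V. openin (zariski X) V \<and> x \<in> V \<and> V \<subseteq> U \<and> restr X U V s \<in> Units (sections X V))"

text \<open>The stalks are local rings: they are nonzero and their nonunits are closed under addition.\<close>

definition locally_ringed :: "('p, 's) rspace \<Rightarrow> bool" where
  "locally_ringed X \<longleftrightarrow> sheaf_of_algebras X \<and>
     (\<forall>U x. openin (zariski X) U \<and> x \<in> U \<longrightarrow>
        \<not> unit_at X U \<zero>\<^bsub>sections X U\<^esub> x \<and>
        (\<forall>s\<in>carrier (sections X U). \<forall>t\<in>carrier (sections X U).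
           unit_at X U (s \<oplus>\<^bsub>sections X U\<^esub> t) x \<longrightarrow> unit_at X U s x \<or> unit_at X U t x))"

definition open_subspace :: "('p, 's) rspace \<Rightarrow> 'p set \<Rightarrow> ('p, 's) rspace" where
  "open_subspace X U = X\<lparr>zariski := subtopology (zariski X) U\<rparr>"

definition nonvanishing_locus :: "('p, 's) rspace \<Rightarrow> 's \<Rightarrow> 'p set" where
  "nonvanishing_locus X f = {x \<in> points X. unit_at X (points X) f x}"

text \<open>
  Affine means isomorphic to \<open>Spec A\<close> for the ring \<open>A\<close> of global sections. Sending \<open>x\<close> to the prime
  of sections vanishing at \<open>x\<close> must be a bijection onto the prime ideals of \<open>A\<close> under which the
  Zariski topology has the sets \<open>D(f)\<close> as a basis, and the sections over \<open>D(f)\<close> must form the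
  localization \<open>A\<^sub>f\<close>.
\<close>

definition affine :: "('p, 's) rspace \<Rightarrow> bool" where
  "affine X \<longleftrightarrow> locally_ringed X \<and>
     (let A = sections X (points X); D = nonvanishing_locus X; \<rho> = (\<lambda>f. restr X (points X) (D f)) in
        bij_betw (\<lambda>x. {s \<in> carrier A. \<not> unit_at X (points X) s x}) (points X)
          {P. primeideal P A} \<and>
        (\<forall>U. openin (zariski X) U \<longleftrightarrow> (\<exists>S\<subseteq>carrier A. U = (\<Union>f\<in>S. D f))) \<and>
        (\<forall>f\<in>carrier A.
           \<rho> f f \<in> Units (sections X (D f)) \<and>
           (\<forall>t\<in>carrier (sections X (D f)). \<exists>a\<in>carrier A. \<exists>n::nat.
              t \<otimes>\<^bsub>sections X (D f)\<^esub> \<rho> f (f [^]\<^bsub>A\<^esub> n) = \<rho> f a) \<and>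
           (\<forall>a\<in>carrier A. \<rho> f a = \<zero>\<^bsub>sections X (D f)\<^esub> \<longrightarrow>
              (\<exists>n::nat. (f [^]\<^bsub>A\<^esub> n) \<otimes>\<^bsub>A\<^esub> a = \<zero>\<^bsub>A\<^esub>))))"

definition affine_open :: "('p, 's) rspace \<Rightarrow> 'p set \<Rightarrow> bool" where
  "affine_open X U \<longleftrightarrow> openin (zariski X) U \<and> affine (open_subspace X U)"

definition scheme :: "('p, 's) rspace \<Rightarrow> bool" where
  "scheme X \<longleftrightarrow> locally_ringed X \<and> (\<forall>x\<in>points X. \<exists>U. affine_open X U \<and> x \<in> U)"

definition reduced :: "('p, 's) rspace \<Rightarrow> bool" where
  "reduced X \<longleftrightarrow>
     (\<forall>U. openin (zariski X) U \<longrightarrow>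
        (\<forall>s\<in>carrier (sections X U). \<forall>n::nat.
           s [^]\<^bsub>sections X U\<^esub> n = \<zero>\<^bsub>sections X U\<^esub> \<longrightarrow> s = \<zero>\<^bsub>sections X U\<^esub>))"

definition algebra_generators :: "('p, 's) rspace \<Rightarrow> 'p set \<Rightarrow> 's set \<Rightarrow> bool" where
  "algebra_generators X U S \<longleftrightarrow> S \<subseteq> carrier (sections X U) \<and>
     generate_ring (sections X U) (S \<union> range (const_sec X U)) = carrier (sections X U)"

definition scheme_of_finite_type :: "('p, 's) rspace \<Rightarrow> bool" where
  "scheme_of_finite_type X \<longleftrightarrow> scheme X \<and>
     (\<exists>\<U>. finite \<U> \<and> \<Union>\<U> = points X \<and>
        (\<forall>U\<in>\<U>. affine_open X U \<and> (\<exists>S. finite S \<and> algebra_generators X U S)))"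


section \<open>Morphisms\<close>

text \<open>
  A morphism from \<open>X\<close> to \<open>Y\<close> is a map \<open>f\<close> of points with maps \<open>O\<^sub>Y(V) \<rightarrow> O\<^sub>X(f\<^sup>-\<^sup>1 V)\<close>. Since both components
  are total functions, morphisms are compared by \<open>same_morphism\<close>.
\<close>

type_synonym ('p, 's, 'q, 't) morphism = "('p \<Rightarrow> 'q) \<times> ('q set \<Rightarrow> 't \<Rightarrow> 's)"

definition preimage :: "('p, 's) rspace \<Rightarrow> ('p, 's, 'q, 't) morphism \<Rightarrow> 'q set \<Rightarrow> 'p set" where
  "preimage X f V = {x \<in> points X. fst f x \<in> V}"

definition morphism ::
    "('p, 's) rspace \<Rightarrow> ('q, 't) rspace \<Rightarrow> ('p, 's, 'q, 't) morphism \<Rightarrow> bool" where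
  "morphism X Y f \<longleftrightarrow> continuous_map (zariski X) (zariski Y) (fst f) \<and>
     (\<forall>V. openin (zariski Y) V \<longrightarrow>
        snd f V \<in> ring_hom (sections Y V) (sections X (preimage X f V)) \<and>
        (\<forall>r. snd f V (const_sec Y V r) = const_sec X (preimage X f V) r) \<and>
        (\<forall>s\<in>carrier (sections Y V). \<forall>x\<in>preimage X f V.
           unit_at X (preimage X f V) (snd f V s) x \<longrightarrow> unit_at Y V s (fst f x))) \<and>
     (\<forall>V W. openin (zariski Y) V \<and> openin (zariski Y) W \<and> W \<subseteq> V \<longrightarrow>
        (\<forall>s\<in>carrier (sections Y V).
           restr X (preimage X f V) (preimage X f W) (snd f V s) = snd f W (restr Y V W s)))"

definition same_morphism ::
    "('p, 's) rspace \<Rightarrow> ('q, 't) rspace \<Rightarrow>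
     ('p, 's, 'q, 't) morphism \<Rightarrow> ('p, 's, 'q, 't) morphism \<Rightarrow> bool" where
  "same_morphism X Y f g \<longleftrightarrow> (\<forall>x\<in>points X. fst f x = fst g x) \<and>
     (\<forall>V. openin (zariski Y) V \<longrightarrow> (\<forall>s\<in>carrier (sections Y V). snd f V s = snd g V s))"

definition id_morphism :: "('p, 's, 'p, 's) morphism" where
  "id_morphism = (\<lambda>x. x, \<lambda>V s. s)"

text \<open>The composite of \<open>f : X \<rightarrow> Y\<close> and \<open>g : Y \<rightarrow> Z\<close> is \<open>comp_morphism Y g f\<close>.\<close>

definition comp_morphism ::
    "('q, 't) rspace \<Rightarrow> ('q, 't, 'r, 'u) morphism \<Rightarrow> ('p, 's, 'q, 't) morphism \<Rightarrow>
     ('p, 's, 'r, 'u) morphism" where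
  "comp_morphism Y g f = (\<lambda>x. fst g (fst f x), \<lambda>W s. snd f (preimage Y g W) (snd g W s))"

text \<open>
  A scheme of finite type over \<open>\<real>\<close> has at most continuum many points and sections, so up to
  isomorphism all of them occur with both types equal to \<^typ>\<open>real\<close>. Quantification over auxiliary
  schemes uses this type.
\<close>

type_synonym small_space = "(real, real) rspace"

definition Spec_R :: small_space where
  "Spec_R = \<lparr>zariski = discrete_topology {0},
     sections = (\<lambda>U. if U = {} then real_ring\<lparr>carrier := {0}, one := 0\<rparr> else real_ring),
     restr = (\<lambda>U V s. if V = {} then 0 else s),
     const_sec = (\<lambda>U r. if U = {} then 0 else r)\<rparr>"

definition structure_morphism :: "('p, 's) rspace \<Rightarrow> ('p, 's, real, real) morphism" where
  "structure_morphism X =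
     (\<lambda>x. 0, \<lambda>V r. if V = {} then \<zero>\<^bsub>sections X {}\<^esub> else const_sec X (points X) r)"

text \<open>
  Fibre product \<open>P = X \<times>\<^sub>B Y\<close>, with projections \<open>a\<close> and \<open>b\<close>, in the category of schemes of finite type
  over \<open>\<real>\<close>; that category is closed under fibre products of schemes.
\<close>

definition fibre_product ::
    "('p, 's) rspace \<Rightarrow> ('q, 't) rspace \<Rightarrow> ('r, 'u) rspace \<Rightarrow>
     ('p, 's, 'r, 'u) morphism \<Rightarrow> ('q, 't, 'r, 'u) morphism \<Rightarrow>
     small_space \<Rightarrow> (real, real, 'p, 's) morphism \<Rightarrow> (real, real, 'q, 't) morphism \<Rightarrow> bool" where
  "fibre_product X Y B f g P a b \<longleftrightarrow>
     scheme_of_finite_type P \<and> morphism P X a \<and> morphism P Y b \<and>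
     same_morphism P B (comp_morphism X f a) (comp_morphism Y g b) \<and>
     (\<forall>(T :: small_space) u v.
        scheme_of_finite_type T \<and> morphism T X u \<and> morphism T Y v \<and>
        same_morphism T B (comp_morphism X f u) (comp_morphism Y g v) \<longrightarrow>
        (\<exists>w. morphism T P w \<and> same_morphism T X (comp_morphism P a w) u \<and>
             same_morphism T Y (comp_morphism P b w) v \<and>
             (\<forall>w'. morphism T P w' \<and> same_morphism T X (comp_morphism P a w') u \<and>
                   same_morphism T Y (comp_morphism P b w') v \<longrightarrow> same_morphism T P w' w)))"

definition closed_immersion ::
    "('p, 's) rspace \<Rightarrow> ('q, 't) rspace \<Rightarrow> ('p, 's, 'q, 't) morphism \<Rightarrow> bool" where
  "closed_immersion X Y f \<longleftrightarrow> morphism X Y f \<and>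
     embedding_map (zariski X) (zariski Y) (fst f) \<and> closedin (zariski Y) (fst f ` points X) \<and>
     (\<forall>V y t. openin (zariski Y) V \<and> y \<in> V \<and> t \<in> carrier (sections X (preimage X f V)) \<longrightarrow>
        (\<exists>W s. openin (zariski Y) W \<and> y \<in> W \<and> W \<subseteq> V \<and> s \<in> carrier (sections Y W) \<and>
           snd f W s = restr X (preimage X f V) (preimage X f W) t))"

definition open_immersion ::
    "('p, 's) rspace \<Rightarrow> ('q, 't) rspace \<Rightarrow> ('p, 's, 'q, 't) morphism \<Rightarrow> bool" where
  "open_immersion X Y f \<longleftrightarrow> morphism X Y f \<and>
     embedding_map (zariski X) (zariski Y) (fst f) \<and> openin (zariski Y) (fst f ` points X) \<and>
     (\<forall>V. openin (zariski Y) V \<and> V \<subseteq> fst f ` points X \<longrightarrow>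
        bij_betw (snd f V) (carrier (sections Y V)) (carrier (sections X (preimage X f V))))"

definition separated_morphism ::
    "('p, 's) rspace \<Rightarrow> ('q, 't) rspace \<Rightarrow> ('p, 's, 'q, 't) morphism \<Rightarrow> bool" where
  "separated_morphism X Y f \<longleftrightarrow>
     (\<exists>P a b diag. fibre_product X X Y f f P a b \<and> closed_immersion X P diag \<and>
        same_morphism X X (comp_morphism P a diag) id_morphism \<and>
        same_morphism X X (comp_morphism P b diag) id_morphism)"

text \<open>
  Used only between schemes of finite type over \<open>\<real>\<close>: there every morphism is of finite type, and
  universal closedness can be tested on base changes of finite type.
\<close>

definition proper_morphism ::
    "('p, 's) rspace \<Rightarrow> ('q, 't) rspace \<Rightarrow> ('p, 's, 'q, 't) morphism \<Rightarrow> bool" where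
  "proper_morphism X Y f \<longleftrightarrow> morphism X Y f \<and> separated_morphism X Y f \<and>
     (\<forall>(T :: small_space) g P a b.
        scheme_of_finite_type T \<and> morphism T Y g \<and> fibre_product X T Y f g P a b \<longrightarrow>
        closed_map (zariski P) (zariski T) (fst b))"


section \<open>Real algebraic varieties with a group action\<close>

definition real_variety :: "('p, 's) rspace \<Rightarrow> bool" where
  "real_variety X \<longleftrightarrow> scheme_of_finite_type X \<and> reduced X \<and>
     separated_morphism X Spec_R (structure_morphism X)"

definition complete_variety :: "('p, 's) rspace \<Rightarrow> bool" where
  "complete_variety X \<longleftrightarrow> real_variety X \<and> proper_morphism X Spec_R (structure_morphism X)"

definition compactification ::
    "('p, 's) rspace \<Rightarrow> small_space \<Rightarrow> ('p, 's, real, real) morphism \<Rightarrow> bool" where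
  "compactification X Y j \<longleftrightarrow> complete_variety Y \<and> open_immersion X Y j \<and>
     zariski Y closure_of (fst j ` points X) = points Y"

definition real_G_variety ::
    "('g, 'e) monoid_scheme \<Rightarrow> ('p, 's) rspace \<Rightarrow> ('g \<Rightarrow> ('p, 's, 'p, 's) morphism) \<Rightarrow> bool" where
  "real_G_variety G X \<alpha> \<longleftrightarrow> real_variety X \<and>
     (\<forall>g\<in>carrier G. morphism X X (\<alpha> g)) \<and>
     same_morphism X X (\<alpha> \<one>\<^bsub>G\<^esub>) id_morphism \<and>
     (\<forall>g\<in>carrier G. \<forall>h\<in>carrier G.
        same_morphism X X (\<alpha> (g \<otimes>\<^bsub>G\<^esub> h)) (comp_morphism X (\<alpha> g) (\<alpha> h))) \<and>
     (\<forall>x\<in>points X. \<exists>U. affine_open X U \<and> (\<forall>g\<in>carrier G. fst (\<alpha> g) x \<in> U))"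

definition irreducible_closed :: "'p topology \<Rightarrow> 'p set \<Rightarrow> bool" where
  "irreducible_closed T Z \<longleftrightarrow> closedin T Z \<and> Z \<noteq> {} \<and>
     (\<forall>A B. closedin T A \<and> closedin T B \<and> Z \<subseteq> A \<union> B \<longrightarrow> Z \<subseteq> A \<or> Z \<subseteq> B)"

text \<open>Krull dimension; the empty space has dimension \<open>-\<infinity>\<close>.\<close>

definition krull_dim :: "'p topology \<Rightarrow> ereal" where
  "krull_dim T =
     (SUP Zs \<in> {Zs. Zs \<noteq> [] \<and> (\<forall>Z\<in>set Zs. irreducible_closed T Z) \<and> sorted_wrt (\<subset>) Zs}.
        ereal (real (length Zs) - 1))"


section \<open>Real points and semialgebraic sets\<close>

text \<open>Points with residue field \<open>\<real>\<close>.\<close>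

definition real_points :: "('p, 's) rspace \<Rightarrow> 'p set" where
  "real_points X = {x \<in> points X. \<forall>U. openin (zariski X) U \<and> x \<in> U \<longrightarrow>
     (\<forall>s\<in>carrier (sections X U). \<exists>r.
        \<not> unit_at X U (s \<ominus>\<^bsub>sections X U\<^esub> const_sec X U r) x)}"

definition sec_value :: "('p, 's) rspace \<Rightarrow> 'p set \<Rightarrow> 's \<Rightarrow> 'p \<Rightarrow> real" where
  "sec_value X U s x = (THE r. \<not> unit_at X U (s \<ominus>\<^bsub>sections X U\<^esub> const_sec X U r) x)"

definition positive_set :: "('p, 's) rspace \<Rightarrow> 'p set \<Rightarrow> 's \<Rightarrow> 'p set" where
  "positive_set X U s = {x \<in> real_points X \<inter> U. sec_value X U s x > 0}"

text \<open>The topology on the real points induced by the topology of \<open>\<real>\<close>.\<close>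

definition euclidean_top :: "('p, 's) rspace \<Rightarrow> 'p topology" where
  "euclidean_top X = topology_generated_by
     {positive_set X U s |U s. openin (zariski X) U \<and> s \<in> carrier (sections X U)}"

inductive_set affine_semialgebraic :: "('p, 's) rspace \<Rightarrow> 'p set \<Rightarrow> 'p set set"
  for X U where
  positive: "s \<in> carrier (sections X U) \<Longrightarrow> positive_set X U s \<in> affine_semialgebraic X U"
| compl: "A \<in> affine_semialgebraic X U \<Longrightarrow> real_points X \<inter> U - A \<in> affine_semialgebraic X U"
| union: "A \<in> affine_semialgebraic X U \<Longrightarrow> B \<in> affine_semialgebraic X U \<Longrightarrow>
    A \<union> B \<in> affine_semialgebraic X U"

definition semialgebraic :: "('p, 's) rspace \<Rightarrow> 'p set \<Rightarrow> bool" where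
  "semialgebraic X A \<longleftrightarrow> A \<subseteq> real_points X \<and>
     (\<forall>U. affine_open X U \<longrightarrow> A \<inter> U \<in> affine_semialgebraic X U)"

text \<open>
  The dimension of a semialgebraic set is the Krull dimension of its Zariski closure
  (Bochnak--Coste--Roy, Definition 2.8.1).
\<close>

definition sa_dim :: "('p, 's) rspace \<Rightarrow> 'p set \<Rightarrow> ereal" where
  "sa_dim X A = krull_dim (subtopology (zariski X) (zariski X closure_of A))"


section \<open>Euler characteristic\<close>

definition independent_in :: "('a, 'b) monoid_scheme \<Rightarrow> 'a set \<Rightarrow> bool" where
  "independent_in H S \<longleftrightarrow> S \<subseteq> carrier H \<and>
     (\<forall>n :: 'a \<Rightarrow> int. finprod H (\<lambda>s. s [^]\<^bsub>H\<^esub> n s) S = \<one>\<^bsub>H\<^esub> \<longrightarrow> (\<forall>s\<in>S. n s = 0))"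

definition abelian_rank :: "('a, 'b) monoid_scheme \<Rightarrow> nat" where
  "abelian_rank H = Sup {card S |S. finite S \<and> independent_in H S}"

text \<open>Applied only to compact semialgebraic sets, whose Betti numbers are finite and almost all zero.\<close>

definition betti :: "nat \<Rightarrow> 'a topology \<Rightarrow> nat" where
  "betti i T = abelian_rank (homology_group (int i) T)"

definition euler_char :: "'a topology \<Rightarrow> int" where
  "euler_char T = (\<Sum>i\<in>{i. betti i T \<noteq> 0}. (-1) ^ i * int (betti i T))"


section \<open>Semialgebraic chains with closed supports\<close>

definition closed_sets_dim_le :: "('p, 's) rspace \<Rightarrow> int \<Rightarrow> 'p set set" where
  "closed_sets_dim_le X k =
     {A. semialgebraic X A \<and> closedin (euclidean_top X) A \<and> sa_dim X A \<le> ereal (real_of_int k)}"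

text \<open>
  The vector space over \<open>\<int>\<^sub>2\<close> with basis \<open>closed_sets_dim_le X k\<close>: a finite formal sum is the finite set of
  its terms. Vector spaces over \<open>\<int>\<^sub>2\<close> are abelian groups of exponent two, written multiplicatively
  as everywhere in HOL-Algebra.
\<close>

definition formal_sums :: "('p, 's) rspace \<Rightarrow> int \<Rightarrow> 'p set set monoid" where
  "formal_sums X k = \<lparr>carrier = {u. finite u \<and> u \<subseteq> closed_sets_dim_le X k},
     monoid.mult = (\<lambda>u v. sym_diff u v), one = {}\<rparr>"

definition chain_relations :: "('p, 's) rspace \<Rightarrow> int \<Rightarrow> 'p set set set" where
  "chain_relations X k = generate (formal_sums X k)
     ({{A} \<otimes>\<^bsub>formal_sums X k\<^esub> {B} \<otimes>\<^bsub>formal_sums X k\<^esub> {euclidean_top X closure_of sym_diff A B} |A B.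
         A \<in> closed_sets_dim_le X k \<and> B \<in> closed_sets_dim_le X k} \<union>
      {{A} |A. A \<in> closed_sets_dim_le X k \<and> sa_dim X A < ereal (real_of_int k)})"

type_synonym 'p chain_class = "'p set set set"

definition chain_group :: "('p, 's) rspace \<Rightarrow> int \<Rightarrow> 'p chain_class monoid" where
  "chain_group X k = formal_sums X k Mod chain_relations X k"

definition chain_of :: "('p, 's) rspace \<Rightarrow> int \<Rightarrow> 'p set \<Rightarrow> 'p chain_class" where
  "chain_of X k A = chain_relations X k #>\<^bsub>formal_sums X k\<^esub> {A}"

text \<open>
  Every chain is the class of a single closed semialgebraic set, and among these sets there is a
  smallest one, namely the closure of the points at which any of them has local dimension \<open>k\<close>. Maps on
  chains that are given on generators by \<open>[A] \<mapsto> [T A]\<close> are evaluated on this representative.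
\<close>

definition chain_support :: "('p, 's) rspace \<Rightarrow> int \<Rightarrow> 'p chain_class \<Rightarrow> 'p set" where
  "chain_support X k c = \<Inter>{A \<in> closed_sets_dim_le X k. chain_of X k A = c}"

text \<open>
  \<open>\<partial>A\<close> is the closure of the set of points of \<open>A\<close> whose link \<open>A \<inter> S(x, \<epsilon>)\<close> has odd Euler
  characteristic for all small \<open>\<epsilon>\<close>; the sphere is taken in an affine space into which a neighbourhood
  of \<open>x\<close> is embedded. Without the closure, the common vertex of two opposite sectors would be missing.
\<close>

definition odd_link_at :: "('p, 's) rspace \<Rightarrow> 'p set \<Rightarrow> 'p \<Rightarrow> bool" where
  "odd_link_at X A x \<longleftrightarrow>
     (\<exists>U S. affine_open X U \<and> x \<in> U \<and> finite S \<and> algebra_generators X U S \<and>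
        (\<forall>\<^sub>F \<epsilon> in at_right (0::real). odd (euler_char (subtopology (euclidean_top X)
           {y \<in> A \<inter> U. (\<Sum>s\<in>S. (sec_value X U s y - sec_value X U s x)\<^sup>2) = \<epsilon>\<^sup>2}))))"

definition sa_boundary :: "('p, 's) rspace \<Rightarrow> 'p set \<Rightarrow> 'p set" where
  "sa_boundary X A = euclidean_top X closure_of {x \<in> A. odd_link_at X A x}"

definition chain_boundary :: "('p, 's) rspace \<Rightarrow> int \<Rightarrow> 'p chain_class \<Rightarrow> 'p chain_class" where
  "chain_boundary X k c = chain_of X (k - 1) (sa_boundary X (chain_support X k c))"

definition chain_push ::
    "('p, 's) rspace \<Rightarrow> int \<Rightarrow> ('p, 's, 'p, 's) morphism \<Rightarrow> 'p chain_class \<Rightarrow> 'p chain_class" where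
  "chain_push X k f c = chain_of X k (fst f ` chain_support X k c)"


section \<open>The Nash-constructible filtration\<close>

text \<open>The function \<open>x \<mapsto> \<chi>(f\<^sup>-\<^sup>1(x) \<inter> Z')\<close> on a compactification \<open>Y\<close> of \<open>X\<close>, restricted to \<open>X\<close> along \<open>j\<close>.\<close>

definition nash_generator :: "('p, 's) rspace \<Rightarrow> ('p \<Rightarrow> int) \<Rightarrow> bool" where
  "nash_generator X \<psi> \<longleftrightarrow>
     (\<exists>Y j (Z :: small_space) f Z'.
        compactification X Y j \<and> real_variety Z \<and> proper_morphism Z Y f \<and>
        Z' \<in> connected_components_of (euclidean_top Z) \<and>
        \<psi> = (\<lambda>x. euler_char (subtopology (euclidean_top Z) {z \<in> Z'. fst f z = fst j x})))"

text \<open>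
  Finite integral combinations. The summands need not share a compactification: any two
  compactifications of \<open>X\<close> are dominated by a third, to which the generators can be pulled back.
\<close>

definition nash_constructible :: "('p, 's) rspace \<Rightarrow> ('p \<Rightarrow> int) \<Rightarrow> bool" where
  "nash_constructible X \<psi> \<longleftrightarrow>
     (\<exists>ts :: (int \<times> ('p \<Rightarrow> int)) list. (\<forall>(m, \<gamma>)\<in>set ts. nash_generator X \<gamma>) \<and>
        (\<forall>x\<in>real_points X. \<psi> x = (\<Sum>(m, \<gamma>)\<leftarrow>ts. m * \<gamma> x)))"

text \<open>For \<open>p = 0\<close> the formula for \<open>- k \<le> p \<le> 0\<close> gives all chains as well.\<close>

definition nash_filtration :: "('p, 's) rspace \<Rightarrow> int \<Rightarrow> int \<Rightarrow> 'p chain_class set" where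
  "nash_filtration X p k =
     (if p < - k then {\<one>\<^bsub>chain_group X k\<^esub>}
      else if p \<ge> 0 then carrier (chain_group X k)
      else {c \<in> carrier (chain_group X k).
        \<exists>\<phi> \<psi> S A. (\<forall>x\<in>real_points X. 2 ^ nat (k + p) dvd \<phi> x) \<and>
          nash_constructible X \<psi> \<and>
          semialgebraic X S \<and> sa_dim X S < ereal (real_of_int k) \<and>
          (\<forall>x\<in>real_points X - S. \<phi> x = \<psi> x) \<and>
          A \<in> closed_sets_dim_le X k \<and> c = chain_of X k A \<and>
          sa_dim X (sym_diff A {x \<in> real_points X. \<not> 2 ^ nat (k + p + 1) dvd \<phi> x})
            < ereal (real_of_int k)})"


section \<open>Filtered complexes and their spectral sequences\<close>

text \<open>
  \<open>diff K n\<close> maps degree \<open>n\<close> to degree \<open>n - 1\<close>, \<open>filt K p n\<close> is the part of filtration index \<open>p\<close> in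
  degree \<open>n\<close>, and \<open>gact K n\<close> is the action in degree \<open>n\<close>.
\<close>

record 'm filtered_complex =
  grp :: "int \<Rightarrow> 'm monoid"
  diff :: "int \<Rightarrow> 'm \<Rightarrow> 'm"
  filt :: "int \<Rightarrow> int \<Rightarrow> 'm set"

record ('g, 'm) filtered_gcomplex = "'m filtered_complex" +
  gact :: "int \<Rightarrow> 'g \<Rightarrow> 'm \<Rightarrow> 'm"

record ('g, 'm) gmodule = "'m monoid" +
  act :: "'g \<Rightarrow> 'm \<Rightarrow> 'm"

definition page_cycles ::
    "('m, 'z) filtered_complex_scheme \<Rightarrow> int \<Rightarrow> int \<Rightarrow> int \<Rightarrow> 'm set" where
  "page_cycles K r p q = {x \<in> filt K p (p + q). diff K (p + q) x \<in> filt K (p - r) (p + q - 1)}"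

definition page_boundaries ::
    "('m, 'z) filtered_complex_scheme \<Rightarrow> int \<Rightarrow> int \<Rightarrow> int \<Rightarrow> 'm set" where
  "page_boundaries K r p q =
     page_cycles K (r - 1) (p - 1) (q + 1) <#>\<^bsub>grp K (p + q)\<^esub>
     diff K (p + q + 1) ` page_cycles K (r - 1) (p + r - 1) (q - r + 2)"

definition page ::
    "('m, 'z) filtered_complex_scheme \<Rightarrow> int \<Rightarrow> int \<Rightarrow> int \<Rightarrow> 'm set monoid" where
  "page K r p q = (grp K (p + q))\<lparr>carrier := page_cycles K r p q\<rparr> Mod page_boundaries K r p q"

definition page_class ::
    "('m, 'z) filtered_complex_scheme \<Rightarrow> int \<Rightarrow> int \<Rightarrow> int \<Rightarrow> 'm \<Rightarrow> 'm set" where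
  "page_class K r p q x = page_boundaries K r p q #>\<^bsub>grp K (p + q)\<^esub> x"

definition page_module ::
    "('g, 'm) filtered_gcomplex \<Rightarrow> int \<Rightarrow> int \<Rightarrow> int \<Rightarrow> ('g, 'm set) gmodule" where
  "page_module K r p q =
     \<lparr>carrier = carrier (page K r p q), monoid.mult = mult (page K r p q),
      one = one (page K r p q), act = (\<lambda>g C. gact K (p + q) g ` C)\<rparr>"

text \<open>
  The reindexing \<open>p' = 2p + q\<close>, \<open>q' = - p\<close>, \<open>r' = r + 1\<close>, applied to any family indexed by \<open>r, p, q\<close>.
\<close>

definition reindex :: "(int \<Rightarrow> int \<Rightarrow> int \<Rightarrow> 'a) \<Rightarrow> int \<Rightarrow> int \<Rightarrow> int \<Rightarrow> 'a" where
  "reindex E r' p' q' = E (r' - 1) (- q') (p' + 2 * q')"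


section \<open>Group cohomology and the equivariant complex\<close>

definition is_gmodule :: "('g, 'e) monoid_scheme \<Rightarrow> ('g, 'm) gmodule \<Rightarrow> bool" where
  "is_gmodule G M \<longleftrightarrow> comm_group M \<and> (\<forall>g\<in>carrier G. act M g \<in> hom M M) \<and>
     (\<forall>x\<in>carrier M. act M \<one>\<^bsub>G\<^esub> x = x \<and>
        (\<forall>g\<in>carrier G. \<forall>h\<in>carrier G. act M (g \<otimes>\<^bsub>G\<^esub> h) x = act M g (act M h x)))"

definition ghom ::
    "('g, 'e) monoid_scheme \<Rightarrow> ('g, 'm) gmodule \<Rightarrow> ('g, 'n) gmodule \<Rightarrow> ('m \<Rightarrow> 'n) set" where
  "ghom G M N = {f \<in> hom M N \<inter> extensional (carrier M).
     \<forall>g\<in>carrier G. \<forall>x\<in>carrier M. f (act M g x) = act N g (f x)}"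

definition ghom_group ::
    "('g, 'e) monoid_scheme \<Rightarrow> ('g, 'm) gmodule \<Rightarrow> ('g, 'n) gmodule \<Rightarrow> ('m \<Rightarrow> 'n) monoid" where
  "ghom_group G M N = \<lparr>carrier = ghom G M N,
     monoid.mult = (\<lambda>f h. \<lambda>x\<in>carrier M. f x \<otimes>\<^bsub>N\<^esub> h x), one = (\<lambda>x\<in>carrier M. \<one>\<^bsub>N\<^esub>)\<rparr>"

text \<open>
  Projectivity as the lifting property. The type of the test modules contains the free
  \<open>\<int>[G]\<close>-module on the elements of \<open>M\<close> and copies of \<open>M\<close>, which is enough for the general property.
\<close>

definition projective_gmodule :: "('g, 'e) monoid_scheme \<Rightarrow> ('g, 'm) gmodule \<Rightarrow> bool" where
  "projective_gmodule G M \<longleftrightarrow> is_gmodule G M \<and>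
     (\<forall>(A :: ('g, ('g \<times> 'm) \<Rightarrow>\<^sub>0 int) gmodule) (B :: ('g, ('g \<times> 'm) \<Rightarrow>\<^sub>0 int) gmodule) e f.
        is_gmodule G A \<and> is_gmodule G B \<and> e \<in> ghom G A B \<and> e ` carrier A = carrier B \<and>
        f \<in> ghom G M B \<longrightarrow> (\<exists>f'\<in>ghom G M A. \<forall>x\<in>carrier M. e (f' x) = f x))"

text \<open>\<open>res_bd F n\<close> maps \<open>F\<^sub>n\<^sub>+\<^sub>1\<close> to \<open>F\<^sub>n\<close>, and \<open>res_aug F\<close> maps \<open>F\<^sub>0\<close> to \<open>\<int>\<close> with trivial action.\<close>

record ('g, 'f) resolution =
  res_mod :: "nat \<Rightarrow> ('g, 'f) gmodule"
  res_bd :: "nat \<Rightarrow> 'f \<Rightarrow> 'f"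
  res_aug :: "'f \<Rightarrow> int"

definition projective_resolution :: "('g, 'e) monoid_scheme \<Rightarrow> ('g, 'f) resolution \<Rightarrow> bool" where
  "projective_resolution G F \<longleftrightarrow>
     (\<forall>n. projective_gmodule G (res_mod F n) \<and>
          res_bd F n \<in> ghom G (res_mod F (Suc n)) (res_mod F n)) \<and>
     res_aug F \<in> hom (res_mod F 0) integer_group \<and>
     (\<forall>g\<in>carrier G. \<forall>x\<in>carrier (res_mod F 0). res_aug F (act (res_mod F 0) g x) = res_aug F x) \<and>
     res_aug F ` carrier (res_mod F 0) = UNIV \<and>
     res_bd F 0 ` carrier (res_mod F 1) = {x \<in> carrier (res_mod F 0). res_aug F x = 0} \<and>
     (\<forall>n. res_bd F (Suc n) ` carrier (res_mod F (Suc (Suc n))) =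
          {x \<in> carrier (res_mod F (Suc n)). res_bd F n x = \<one>\<^bsub>res_mod F n\<^esub>})"

text \<open>Precomposition with the differential of \<open>F\<close>.\<close>

definition codiff :: "('g, 'f) resolution \<Rightarrow> nat \<Rightarrow> ('f \<Rightarrow> 'm) \<Rightarrow> ('f \<Rightarrow> 'm)" where
  "codiff F n f = (\<lambda>x\<in>carrier (res_mod F (Suc n)). f (res_bd F n x))"

definition cocycles ::
    "('g, 'e) monoid_scheme \<Rightarrow> ('g, 'f) resolution \<Rightarrow> nat \<Rightarrow> ('g, 'm) gmodule \<Rightarrow> ('f \<Rightarrow> 'm) set" where
  "cocycles G F n M = {f \<in> ghom G (res_mod F n) M.
     codiff F n f = (\<lambda>x\<in>carrier (res_mod F (Suc n)). \<one>\<^bsub>M\<^esub>)}"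

definition coboundaries ::
    "('g, 'e) monoid_scheme \<Rightarrow> ('g, 'f) resolution \<Rightarrow> nat \<Rightarrow> ('g, 'm) gmodule \<Rightarrow> ('f \<Rightarrow> 'm) set" where
  "coboundaries G F n M = (case n of
       0 \<Rightarrow> {\<lambda>x\<in>carrier (res_mod F 0). \<one>\<^bsub>M\<^esub>}
     | Suc m \<Rightarrow> codiff F m ` ghom G (res_mod F m) M)"

text \<open>\<open>H\<^sup>n(G, M)\<close>, that is \<open>Ext\<^sup>n(\<int>, M)\<close> over \<open>\<int>[G]\<close>, computed from the projective resolution \<open>F\<close>.\<close>

definition group_cohomology ::
    "('g, 'e) monoid_scheme \<Rightarrow> ('g, 'f) resolution \<Rightarrow> int \<Rightarrow> ('g, 'm) gmodule \<Rightarrow>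
     ('f \<Rightarrow> 'm) set monoid" where
  "group_cohomology G F n M =
     (if n < 0 then singleton_group {}
      else (ghom_group G (res_mod F (nat n)) M)\<lparr>carrier := cocycles G F (nat n) M\<rparr>
             Mod coboundaries G F (nat n) M)"

definition cohomology_class ::
    "('g, 'e) monoid_scheme \<Rightarrow> ('g, 'f) resolution \<Rightarrow> nat \<Rightarrow> ('g, 'm) gmodule \<Rightarrow>
     ('f \<Rightarrow> 'm) \<Rightarrow> ('f \<Rightarrow> 'm) set" where
  "cohomology_class G F n M f =
     coboundaries G F n M #>\<^bsub>ghom_group G (res_mod F n) M\<^esub> f"

definition degree_module :: "('g, 'm) filtered_gcomplex \<Rightarrow> int \<Rightarrow> ('g, 'm) gmodule" where
  "degree_module K q = \<lparr>carrier = carrier (grp K q), monoid.mult = mult (grp K q),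
     one = one (grp K q), act = gact K q\<rparr>"

text \<open>
  An element of \<open>L\<^sub>k(K)\<close> is a family \<open>(u q)\<close> with \<open>u q\<close> in \<open>Hom\<^sub>G(F\<^sub>q\<^sub>-\<^sub>k, K\<^sub>q)\<close> for \<open>q \<ge> k\<close>, where \<open>F\<^sub>n = 0\<close> for
  \<open>n < 0\<close>. As \<open>K\<close> is bounded, the direct sum over \<open>q\<close> is the product. No signs are needed in the total
  differential since \<open>K\<close> is killed by two.
\<close>

definition total_group ::
    "('g, 'e) monoid_scheme \<Rightarrow> ('g, 'f) resolution \<Rightarrow> ('g, 'm) filtered_gcomplex \<Rightarrow> int \<Rightarrow>
     (int \<Rightarrow> 'f \<Rightarrow> 'm) monoid" where
  "total_group G F K k =
     product_group {k..} (\<lambda>q. ghom_group G (res_mod F (nat (q - k))) (degree_module K q))"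

definition total_diff ::
    "('g, 'f) resolution \<Rightarrow> ('g, 'm) filtered_gcomplex \<Rightarrow> int \<Rightarrow>
     (int \<Rightarrow> 'f \<Rightarrow> 'm) \<Rightarrow> (int \<Rightarrow> 'f \<Rightarrow> 'm)" where
  "total_diff F K k u = (\<lambda>q\<in>{k - 1..}. \<lambda>x\<in>carrier (res_mod F (nat (q - (k - 1)))).
     if q \<ge> k then diff K (q + 1) (u (q + 1) x) \<otimes>\<^bsub>grp K q\<^esub> codiff F (nat (q - k)) (u q) x
     else diff K (q + 1) (u (q + 1) x))"

definition L_complex ::
    "('g, 'e) monoid_scheme \<Rightarrow> ('g, 'f) resolution \<Rightarrow> ('g, 'm) filtered_gcomplex \<Rightarrow>
     (int \<Rightarrow> 'f \<Rightarrow> 'm) filtered_complex" where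
  "L_complex G F K = \<lparr>grp = total_group G F K, diff = total_diff F K,
     filt = (\<lambda>\<alpha> k. {u \<in> carrier (total_group G F K k).
       \<forall>q\<in>{k..}. \<forall>x\<in>carrier (res_mod F (nat (q - k))). u q x \<in> filt K \<alpha> q})\<rparr>"

text \<open>The element of \<open>L\<^sub>k(K)\<close> with component \<open>f\<close> in \<open>K\<close>-degree \<open>d\<close> and all other components zero.\<close>

definition single_degree ::
    "('g, 'f) resolution \<Rightarrow> ('g, 'm) filtered_gcomplex \<Rightarrow> int \<Rightarrow> int \<Rightarrow> ('f \<Rightarrow> 'm) \<Rightarrow>
     (int \<Rightarrow> 'f \<Rightarrow> 'm)" where
  "single_degree F K k d f = (\<lambda>q\<in>{k..}.
     if q = d then f else (\<lambda>x\<in>carrier (res_mod F (nat (q - k))). \<one>\<^bsub>grp K q\<^esub>))"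


section \<open>Weight complexes and weight spectral sequences\<close>

definition weight_complex ::
    "('p, 's) rspace \<Rightarrow> ('g \<Rightarrow> ('p, 's, 'p, 's) morphism) \<Rightarrow>
     ('g, 'p chain_class) filtered_gcomplex" where
  "weight_complex X \<alpha> = \<lparr>grp = chain_group X, diff = chain_boundary X, filt = nash_filtration X,
     gact = (\<lambda>k g. chain_push X k (\<alpha> g))\<rparr>"

definition equivariant_weight_complex ::
    "('g, 'e) monoid_scheme \<Rightarrow> ('g, 'f) resolution \<Rightarrow> ('p, 's) rspace \<Rightarrow>
     ('g \<Rightarrow> ('p, 's, 'p, 's) morphism) \<Rightarrow> (int \<Rightarrow> 'f \<Rightarrow> 'p chain_class) filtered_complex" where
  "equivariant_weight_complex G F X \<alpha> = L_complex G F (weight_complex X \<alpha>)"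

definition weight_page ::
    "('p, 's) rspace \<Rightarrow> ('g \<Rightarrow> ('p, 's, 'p, 's) morphism) \<Rightarrow> int \<Rightarrow> int \<Rightarrow> int \<Rightarrow>
     ('g, 'p chain_class set) gmodule" where
  "weight_page X \<alpha> = reindex (page_module (weight_complex X \<alpha>))"

definition weight_class ::
    "('p, 's) rspace \<Rightarrow> ('g \<Rightarrow> ('p, 's, 'p, 's) morphism) \<Rightarrow> int \<Rightarrow> int \<Rightarrow> int \<Rightarrow>
     'p chain_class \<Rightarrow> 'p chain_class set" where
  "weight_class X \<alpha> = reindex (page_class (weight_complex X \<alpha>))"

definition weight_cycles ::
    "('p, 's) rspace \<Rightarrow> ('g \<Rightarrow> ('p, 's, 'p, 's) morphism) \<Rightarrow> int \<Rightarrow> int \<Rightarrow> int \<Rightarrow>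
     'p chain_class set" where
  "weight_cycles X \<alpha> = reindex (page_cycles (weight_complex X \<alpha>))"

definition equivariant_weight_page ::
    "('g, 'e) monoid_scheme \<Rightarrow> ('g, 'f) resolution \<Rightarrow> ('p, 's) rspace \<Rightarrow>
     ('g \<Rightarrow> ('p, 's, 'p, 's) morphism) \<Rightarrow> int \<Rightarrow> int \<Rightarrow> int \<Rightarrow>
     (int \<Rightarrow> 'f \<Rightarrow> 'p chain_class) set monoid" where
  "equivariant_weight_page G F X \<alpha> = reindex (page (equivariant_weight_complex G F X \<alpha>))"

definition equivariant_weight_class ::
    "('g, 'e) monoid_scheme \<Rightarrow> ('g, 'f) resolution \<Rightarrow> ('p, 's) rspace \<Rightarrow>
     ('g \<Rightarrow> ('p, 's, 'p, 's) morphism) \<Rightarrow> int \<Rightarrow> int \<Rightarrow> int \<Rightarrow>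
     (int \<Rightarrow> 'f \<Rightarrow> 'p chain_class) \<Rightarrow> (int \<Rightarrow> 'f \<Rightarrow> 'p chain_class) set" where
  "equivariant_weight_class G F X \<alpha> = reindex (page_class (equivariant_weight_complex G F X \<alpha>))"

text \<open>
  The canonical map sends the class of a cocycle with values in the weight spectral sequence to the
  class of the element of \<open>L\<close> given by a lift of that cocycle to chains of degree \<open>d\<close>.
\<close>

definition canonical_map ::
    "('g, 'e) monoid_scheme \<Rightarrow> ('g, 'f) resolution \<Rightarrow> ('p, 's) rspace \<Rightarrow>
     ('g \<Rightarrow> ('p, 's, 'p, 's) morphism) \<Rightarrow> int \<Rightarrow> int \<Rightarrow>
     (('f \<Rightarrow> 'p chain_class set) set \<Rightarrow> (int \<Rightarrow> 'f \<Rightarrow> 'p chain_class) set) \<Rightarrow> bool" where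
  "canonical_map G F X \<alpha> d p h \<longleftrightarrow>
     (p \<le> 0 \<longrightarrow>
        (\<forall>f \<in> cocycles G F (nat (- p)) (degree_module (weight_complex X \<alpha>) d).
           f ` carrier (res_mod F (nat (- p))) \<subseteq> weight_cycles X \<alpha> 2 0 d \<longrightarrow>
           h (cohomology_class G F (nat (- p)) (weight_page X \<alpha> 2 0 d)
                (\<lambda>x\<in>carrier (res_mod F (nat (- p))). weight_class X \<alpha> 2 0 d (f x))) =
           equivariant_weight_class G F X \<alpha> 2 p d
             (single_degree F (weight_complex X \<alpha>) (p + d) d f)))"

end

theory Submission
  imports Defs
begin

text \<open>
  Above degree \<open>d\<close> all chains vanish, and below degree \<open>d\<close> so does the filtration step \<open>-d\<close>. Hence both
  sides are quotients of the set of equivariant cocycles on \<open>F\<close> with values in the \<open>d\<close>-cycles of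
  filtration index \<open>-d\<close>, by the coboundaries of such cochains; one side wraps values into singleton
  classes, the other side pads with zeros in the remaining degrees. The isomorphism is therefore a
  transport along two injections, so additivity of the boundary and of the action on chains never
  enters.
\<close>

text \<open>Undoing the reindexing, both sides live in column -d of the first page: the module is
  E^1_{-d,2d} of the weight complex, in total degree d, and the equivariant term is E^1_{-d,p+2d} of
  the complex \<open>L\<close>, in total degree p + d, so its component in chain degree d is a
  cochain on the module of the resolution in degree -p. The index -d is the lowest one that matters,
  because the filtration in degree q starts at -q and q is at most d. Step -d - 1 is therefore
  trivial in every degree, and the first page in this column is the homology of step -d itself. A
  class on the module side has exactly one representative, so lifting a cocycle to chains involves
  no choice. On the geometric side \<open>chain_boundary\<close> and \<open>chain_push\<close> are
  given by formulas on supports; what is established about them is their value on the zero chain and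
  a unit law for boundaries, and the algebra is arranged to run on these facts.\<close>

section \<open>Quotients transported along injections\<close>

lemma r_coset_image: "H #>\<^bsub>G\<^esub> a = (\<lambda>h. h \<otimes>\<^bsub>G\<^esub> a) ` H"
  by (auto simp: r_coset_def)

lemma set_mult_image: "H <#>\<^bsub>G\<^esub> K = (\<Union>h\<in>H. (\<lambda>k. h \<otimes>\<^bsub>G\<^esub> k) ` K)"
  by (auto simp: set_mult_def)

lemma RCOSETS_image: "RCOSETS G H = (\<lambda>a. H #>\<^bsub>G\<^esub> a) ` carrier G"
  by (auto simp: RCOSETS_def)

lemma r_coset_update: "H #>\<^bsub>G\<lparr>carrier := C\<rparr>\<^esub> a = H #>\<^bsub>G\<^esub> a"
  by (simp add: r_coset_def)

text \<open>\<open>Mod\<close> builds cosets and their set products from the multiplication alone.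
  Since \<open>s\<close> and \<open>t\<close> are multiplicative and injective on \<open>U\<close>,
  a coset of \<open>B\<close> formed in \<open>P\<close> has one image in \<open>P1\<close> and one
  in \<open>P2\<close>; going back along \<open>s\<close> and forward along \<open>t\<close> is the
  isomorphism. Closure under products is asked of the ambient \<open>U\<close>; \<open>Z\<close> and
  \<open>B\<close> are arbitrary subsets of it.\<close>

lemma FactGroup_iso_of_injections:
  fixes P :: "('a, 'x) monoid_scheme" and P1 :: "('b, 'y) monoid_scheme"
    and P2 :: "('c, 'z) monoid_scheme"
  assumes closed: "\<And>f g. f \<in> U \<Longrightarrow> g \<in> U \<Longrightarrow> f \<otimes>\<^bsub>P\<^esub> g \<in> U"
    and s: "\<And>f g. f \<in> U \<Longrightarrow> g \<in> U \<Longrightarrow> s (f \<otimes>\<^bsub>P\<^esub> g) = s f \<otimes>\<^bsub>P1\<^esub> s g" "inj_on s U"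
    and t: "\<And>f g. f \<in> U \<Longrightarrow> g \<in> U \<Longrightarrow> t (f \<otimes>\<^bsub>P\<^esub> g) = t f \<otimes>\<^bsub>P2\<^esub> t g" "inj_on t U"
    and Z: "Z \<subseteq> U" and B: "B \<subseteq> U"
  shows "\<exists>h \<in> iso (P1\<lparr>carrier := s ` Z\<rparr> Mod s ` B) (P2\<lparr>carrier := t ` Z\<rparr> Mod t ` B).
     \<forall>f\<in>Z. h (s ` B #>\<^bsub>P1\<^esub> s f) = t ` B #>\<^bsub>P2\<^esub> t f"
proof -
  define h where "h = (\<lambda>C. t ` inv_into U s ` C)"
  \<comment> \<open>On images of subsets of \<open>U\<close>, \<open>h\<close> just replaces
    \<open>s\<close> by \<open>t\<close>; everything below reduces to this rule.\<close>
  have h: "h (s ` C) = t ` C" if "C \<subseteq> U" for C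
    using that s(2) by (simp add: h_def inv_into_image_cancel)
  have closed': "B #>\<^bsub>P\<^esub> f \<subseteq> U" if "f \<in> U" for f
    using B that closed by (auto simp: r_coset_def subset_iff)
  have closed_prod: "C <#>\<^bsub>P\<^esub> D \<subseteq> U" if "C \<subseteq> U" "D \<subseteq> U" for C D
    using that closed by (auto simp: set_mult_def subset_iff)
  have hB: "h (s ` (B #>\<^bsub>P\<^esub> f)) = t ` (B #>\<^bsub>P\<^esub> f)" if "f \<in> U" for f
    using that by (intro h closed')
  have coset: "s ` B #>\<^bsub>P1\<^esub> s f = s ` (B #>\<^bsub>P\<^esub> f)" "t ` B #>\<^bsub>P2\<^esub> t f = t ` (B #>\<^bsub>P\<^esub> f)"
    if "f \<in> U" for f
    using B that unfolding r_coset_image image_image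
    by (auto simp: s(1) t(1) subset_iff intro!: image_cong)
  have prod: "s ` C <#>\<^bsub>P1\<^esub> s ` D = s ` (C <#>\<^bsub>P\<^esub> D)" "t ` C <#>\<^bsub>P2\<^esub> t ` D = t ` (C <#>\<^bsub>P\<^esub> D)"
    if "C \<subseteq> U" "D \<subseteq> U" for C D
    using that unfolding set_mult_image image_image image_UN UN_simps
    by (auto simp: s(1) t(1) subset_iff intro!: SUP_cong image_cong)
  have rc: "carrier (P1\<lparr>carrier := s ` Z\<rparr> Mod s ` B) = (\<lambda>f. s ` (B #>\<^bsub>P\<^esub> f)) ` Z"
    "carrier (P2\<lparr>carrier := t ` Z\<rparr> Mod t ` B) = (\<lambda>f. t ` (B #>\<^bsub>P\<^esub> f)) ` Z"
    using Z by (auto simp: FactGroup_def RCOSETS_image r_coset_update image_image coset subset_iff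
        intro!: image_cong)
  have "h \<in> iso (P1\<lparr>carrier := s ` Z\<rparr> Mod s ` B) (P2\<lparr>carrier := t ` Z\<rparr> Mod t ` B)"
    unfolding iso_def hom_def bij_betw_def
  proof (intro CollectI conjI ballI funcsetI)
    fix x assume "x \<in> carrier (P1\<lparr>carrier := s ` Z\<rparr> Mod s ` B)"
    then show "h x \<in> carrier (P2\<lparr>carrier := t ` Z\<rparr> Mod t ` B)"
      using Z by (auto simp: rc hB subset_iff)
  next
    fix x y assume "x \<in> carrier (P1\<lparr>carrier := s ` Z\<rparr> Mod s ` B)"
      "y \<in> carrier (P1\<lparr>carrier := s ` Z\<rparr> Mod s ` B)"
    then obtain f g where fg: "f \<in> U" "g \<in> U" "x = s ` (B #>\<^bsub>P\<^esub> f)" "y = s ` (B #>\<^bsub>P\<^esub> g)"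
      using Z by (auto simp: rc)
    have "h (x <#>\<^bsub>P1\<^esub> y) = h x <#>\<^bsub>P2\<^esub> h y"
      using fg by (simp add: prod h closed' closed_prod)
    then show "h (x \<otimes>\<^bsub>P1\<lparr>carrier := s ` Z\<rparr> Mod s ` B\<^esub> y) =
        h x \<otimes>\<^bsub>P2\<lparr>carrier := t ` Z\<rparr> Mod t ` B\<^esub> h y"
      by (simp add: FactGroup_def set_mult_def)
  next
    show "inj_on h (carrier (P1\<lparr>carrier := s ` Z\<rparr> Mod s ` B))"
    proof (rule inj_onI)
      fix x y assume "x \<in> carrier (P1\<lparr>carrier := s ` Z\<rparr> Mod s ` B)"
        "y \<in> carrier (P1\<lparr>carrier := s ` Z\<rparr> Mod s ` B)" and eq: "h x = h y"
      then obtain f g where fg: "f \<in> U" "g \<in> U" "x = s ` (B #>\<^bsub>P\<^esub> f)" "y = s ` (B #>\<^bsub>P\<^esub> g)"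
        using Z by (auto simp: rc)
      then have "t ` (B #>\<^bsub>P\<^esub> f) = t ` (B #>\<^bsub>P\<^esub> g)"
        using eq by (simp add: hB)
      then show "x = y"
        using fg inj_on_image_eq_iff[OF t(2)] by (simp add: closed')
    qed
  next
    have "h ` (\<lambda>f. s ` (B #>\<^bsub>P\<^esub> f)) ` Z = (\<lambda>f. t ` (B #>\<^bsub>P\<^esub> f)) ` Z"
      unfolding image_image using Z by (intro image_cong refl hB) auto
    then show "h ` carrier (P1\<lparr>carrier := s ` Z\<rparr> Mod s ` B) =
        carrier (P2\<lparr>carrier := t ` Z\<rparr> Mod t ` B)"
      by (simp only: rc)
  qed
  moreover have "h (s ` B #>\<^bsub>P1\<^esub> s f) = t ` B #>\<^bsub>P2\<^esub> t f" if "f \<in> Z" for f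
    using that Z coset hB by (metis subsetD)
  ultimately show ?thesis
    by blast
qed

section \<open>Chain groups as quotients under symmetric difference\<close>

lemma mult_formal_sums: "u \<otimes>\<^bsub>formal_sums X k\<^esub> v = sym_diff u v"
  by (simp add: formal_sums_def)

lemma r_coset_chain_relations:
  "chain_relations X k #>\<^bsub>formal_sums X k\<^esub> u = (\<lambda>r. sym_diff r u) ` chain_relations X k"
  by (auto simp: r_coset_def formal_sums_def)

lemma empty_in_chain_relations: "{} \<in> chain_relations X k"
  using generate.one[of "formal_sums X k"] by (simp add: chain_relations_def formal_sums_def)

lemma sym_diff_in_chain_relations:
  "r \<in> chain_relations X k \<Longrightarrow> s \<in> chain_relations X k \<Longrightarrow> sym_diff r s \<in> chain_relations X k"
  using generate.eng[of r "formal_sums X k" _ s]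
  by (simp add: chain_relations_def formal_sums_def)

lemma small_in_chain_relations:
  "A \<in> closed_sets_dim_le X k \<Longrightarrow> sa_dim X A < ereal (real_of_int k) \<Longrightarrow>
    {A} \<in> chain_relations X k"
  unfolding chain_relations_def by (rule generate.incl) blast

text \<open>Adding \<open>u\<close> twice gives back \<open>r\<close>, so translation by a relation
  is an involution of the set of relations.\<close>

lemma r_coset_chain_relations_eq:
  assumes "u \<in> chain_relations X k"
  shows "chain_relations X k #>\<^bsub>formal_sums X k\<^esub> u = chain_relations X k"
proof -
  have "r \<in> (\<lambda>r. sym_diff r u) ` chain_relations X k" if "r \<in> chain_relations X k" for r
    using that assms by (intro image_eqI[of _ _ "sym_diff r u"] sym_diff_in_chain_relations) auto
  then show ?thesis
    using assms sym_diff_in_chain_relations by (auto simp: r_coset_chain_relations)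
qed

text \<open>
  Sets of sets form a group under \<^const>\<open>sym_diff\<close> in which every element is its own inverse, so the
  relations are a subgroup of it even if some of them do not lie in \<^const>\<open>formal_sums\<close>.
\<close>

lemma set_mult_r_coset_chain_relations:
  "(chain_relations X k #>\<^bsub>formal_sums X k\<^esub> u) <#>\<^bsub>formal_sums X k\<^esub>
   (chain_relations X k #>\<^bsub>formal_sums X k\<^esub> v) =
   chain_relations X k #>\<^bsub>formal_sums X k\<^esub> sym_diff u v"
proof -
  have *: "sym_diff (sym_diff r u) (sym_diff s v) = sym_diff (sym_diff r s) (sym_diff u v)" for r s
    by blast
  have "(\<Union>r\<in>chain_relations X k. (\<lambda>s. sym_diff (sym_diff r s) w) ` chain_relations X k) =
    (\<lambda>r. sym_diff r w) ` chain_relations X k" (is "?l = ?r") for w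
  proof
    show "?l \<subseteq> ?r"
      by (intro UN_least image_subsetI) (rule image_eqI[OF refl], rule sym_diff_in_chain_relations)
    have "sym_diff r w \<in> (\<lambda>s. sym_diff (sym_diff r s) w) ` chain_relations X k" for r
      by (rule image_eqI[of _ _ "{}"]) (simp_all add: empty_in_chain_relations)
    then show "?r \<subseteq> ?l"
      by (intro image_subsetI UN_I)
  qed
  then show ?thesis
    by (simp only: r_coset_chain_relations set_mult_image image_image mult_formal_sums *)
qed

lemma chain_group_sel:
  "\<one>\<^bsub>chain_group X k\<^esub> = chain_relations X k"
  "x \<otimes>\<^bsub>chain_group X k\<^esub> y = x <#>\<^bsub>formal_sums X k\<^esub> y"
  "carrier (chain_group X k) =
     (\<lambda>u. chain_relations X k #>\<^bsub>formal_sums X k\<^esub> u) ` {u. finite u \<and> u \<subseteq> closed_sets_dim_le X k}"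
  by (auto simp: chain_group_def FactGroup_def RCOSETS_def formal_sums_def)

lemma chain_group_one_coset: "\<one>\<^bsub>chain_group X k\<^esub> = chain_relations X k #>\<^bsub>formal_sums X k\<^esub> {}"
  by (simp add: chain_group_sel r_coset_chain_relations)

lemma chain_group_one_closed: "\<one>\<^bsub>chain_group X k\<^esub> \<in> carrier (chain_group X k)"
  by (auto simp: chain_group_sel(3) chain_group_one_coset)

lemma chain_group_closed:
  "x \<in> carrier (chain_group X k) \<Longrightarrow> y \<in> carrier (chain_group X k) \<Longrightarrow>
    x \<otimes>\<^bsub>chain_group X k\<^esub> y \<in> carrier (chain_group X k)"
  by (force simp: chain_group_sel set_mult_r_coset_chain_relations)

lemma chain_group_l_one:
  "x \<in> carrier (chain_group X k) \<Longrightarrow> \<one>\<^bsub>chain_group X k\<^esub> \<otimes>\<^bsub>chain_group X k\<^esub> x = x"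
  by (auto simp: chain_group_sel(2,3) chain_group_one_coset set_mult_r_coset_chain_relations)

text \<open>Cosets of the relations multiply by \<open>sym_diff\<close> of their representatives,
  whether or not \<open>A\<close> is a closed semialgebraic set. Boundaries have the form
  \<open>chain_of\<close>, so they obey the unit law without being located in the carrier.\<close>

lemma chain_of_r_one:
  "chain_of X k A \<otimes>\<^bsub>chain_group X k\<^esub> \<one>\<^bsub>chain_group X k\<^esub> = chain_of X k A"
  by (simp add: chain_of_def chain_group_sel(2) chain_group_one_coset
      set_mult_r_coset_chain_relations)

section \<open>Dimension, and the vanishing of chains above it\<close>

text \<open>Irreducible closed subsets of a closed subspace are closed and irreducible in the whole
  space, so every chain counted for the closure of \<open>A\<close> is counted for the whole space
  too.\<close>

lemma sa_dim_le: "sa_dim X A \<le> krull_dim (zariski X)"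
  unfolding sa_dim_def krull_dim_def
proof (rule SUP_subset_mono)
  let ?C = "zariski X closure_of A"
  have cl: "closedin (zariski X) ?C" by simp
  have "irreducible_closed (zariski X) Z"
    if "irreducible_closed (subtopology (zariski X) ?C) Z" for Z
    unfolding irreducible_closed_def
  proof (intro conjI allI impI)
    show "closedin (zariski X) Z" "Z \<noteq> {}"
      using that cl by (auto simp: irreducible_closed_def closedin_closed_subtopology)
    fix A' B' assume *: "closedin (zariski X) A' \<and> closedin (zariski X) B' \<and> Z \<subseteq> A' \<union> B'"
    have "Z \<subseteq> ?C" using that cl by (auto simp: irreducible_closed_def closedin_closed_subtopology)
    \<comment> \<open>A cover of \<open>Z\<close> by closed sets of the whole space is cut down to
      the subspace, where irreducibility of \<open>Z\<close> applies.\<close>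
    moreover have "closedin (subtopology (zariski X) ?C) (A' \<inter> ?C)"
      "closedin (subtopology (zariski X) ?C) (B' \<inter> ?C)"
      using * cl by (auto simp: closedin_closed_subtopology)
    ultimately show "Z \<subseteq> A' \<or> Z \<subseteq> B'"
      using that * unfolding irreducible_closed_def
      by (metis Int_Un_distrib2 le_inf_iff)
  qed
  then show "{Zs. Zs \<noteq> [] \<and> (\<forall>Z\<in>set Zs. irreducible_closed (subtopology (zariski X) ?C) Z) \<and>
      sorted_wrt (\<subset>) Zs} \<subseteq>
    {Zs. Zs \<noteq> [] \<and> (\<forall>Z\<in>set Zs. irreducible_closed (zariski X) Z) \<and> sorted_wrt (\<subset>) Zs}"
    by blast
qed simp

text \<open>There is no irreducible closed set, so the supremum is over the empty set. The value
  -\<infinity> makes the empty set negligible in every integer degree, including negative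
  ones.\<close>

lemma sa_dim_empty: "sa_dim X {} = - \<infinity>"
proof -
  have "\<not> irreducible_closed (subtopology (zariski X) {}) Z" for Z
    by (auto simp: irreducible_closed_def dest: closedin_subset)
  then have "{Zs. Zs \<noteq> [] \<and> (\<forall>Z\<in>set Zs. irreducible_closed (subtopology (zariski X) {}) Z) \<and>
      sorted_wrt (\<subset>) Zs} = {}"
    by (auto simp: neq_Nil_conv)
  then show ?thesis
    unfolding sa_dim_def krull_dim_def closure_of_empty
    by (simp only: image_empty) (simp add: bot_ereal_def)
qed

text \<open>Each generator has dimension below \<open>k\<close> and so is itself a relation; a
  formal sum is a symmetric difference of generators.\<close>

lemma chain_group_trivial:
  assumes "krull_dim (zariski X) < ereal (real_of_int k)"
  shows "carrier (chain_group X k) = {\<one>\<^bsub>chain_group X k\<^esub>}"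
proof -
  have "u \<in> chain_relations X k" if "finite u" "u \<subseteq> closed_sets_dim_le X k" for u
    using that
  proof (induction u rule: finite_induct)
    case (insert A u)
    have "{A} \<in> chain_relations X k"
      using insert.prems assms sa_dim_le[of X A] by (intro small_in_chain_relations) auto
    then have "sym_diff {A} u \<in> chain_relations X k"
      using insert by (intro sym_diff_in_chain_relations) auto
    moreover have "sym_diff {A} u = insert A u"
      using insert.hyps by auto
    ultimately show ?case by simp
  qed (rule empty_in_chain_relations)
  then show ?thesis
    unfolding chain_group_sel by (auto simp: r_coset_chain_relations_eq
        intro!: image_eqI[of _ _ "{}"] empty_in_chain_relations)
qed

section \<open>The empty set as representative of the zero chain\<close>

lemma real_variety_sections:
  assumes "real_variety X" "openin (zariski X) U"
  shows "\<zero>\<^bsub>sections X U\<^esub> \<in> carrier (sections X U)"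
proof -
  have "cring (sections X U)"
    using assms by (simp add: real_variety_def scheme_of_finite_type_def scheme_def
        locally_ringed_def sheaf_of_algebras_def)
  then interpret cring "sections X U" .
  show ?thesis by simp
qed

text \<open>The inductive definition has no rule for the empty set, so it is produced as the
  complement of the union of a positivity set and its own complement. The zero section only serves
  to have some section to start from.\<close>

lemma semialgebraic_empty:
  assumes "real_variety X"
  shows "semialgebraic X {}"
  unfolding semialgebraic_def
proof (intro conjI allI impI)
  fix U assume "affine_open X U"
  then have "openin (zariski X) U" by (simp add: affine_open_def)
  then have A: "positive_set X U \<zero>\<^bsub>sections X U\<^esub> \<in> affine_semialgebraic X U" (is "?A \<in> _")
    using assms by (intro affine_semialgebraic.positive real_variety_sections)
  have "real_points X \<inter> U - (?A \<union> (real_points X \<inter> U - ?A)) \<in> affine_semialgebraic X U"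
    by (intro affine_semialgebraic.compl affine_semialgebraic.union A)
  also have "real_points X \<inter> U - (?A \<union> (real_points X \<inter> U - ?A)) = {} \<inter> U" by blast
  finally show "{} \<inter> U \<in> affine_semialgebraic X U" .
qed simp

lemma empty_in_closed_sets_dim_le: "real_variety X \<Longrightarrow> {} \<in> closed_sets_dim_le X k"
  by (simp add: closed_sets_dim_le_def semialgebraic_empty sa_dim_empty)

lemma chain_of_empty: "real_variety X \<Longrightarrow> chain_of X k {} = \<one>\<^bsub>chain_group X k\<^esub>"
  unfolding chain_of_def chain_group_sel
  by (intro r_coset_chain_relations_eq small_in_chain_relations empty_in_closed_sets_dim_le)
    (simp_all add: sa_dim_empty)

text \<open>The empty set is one of the representatives being intersected. Hence a map evaluated on
  supports preserves the zero chain as soon as it fixes the empty set.\<close>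

lemma chain_support_one: "real_variety X \<Longrightarrow> chain_support X k \<one>\<^bsub>chain_group X k\<^esub> = {}"
  unfolding chain_support_def using empty_in_closed_sets_dim_le chain_of_empty by blast

lemma chain_boundary_one:
  "real_variety X \<Longrightarrow> chain_boundary X k \<one>\<^bsub>chain_group X k\<^esub> = \<one>\<^bsub>chain_group X (k - 1)\<^esub>"
  by (simp add: chain_boundary_def chain_support_one sa_boundary_def chain_of_empty)

lemma chain_push_one:
  "real_variety X \<Longrightarrow> chain_push X k f \<one>\<^bsub>chain_group X k\<^esub> = \<one>\<^bsub>chain_group X k\<^esub>"
  by (simp add: chain_push_def chain_support_one chain_of_empty)

text \<open>The zero function is the empty combination of generators and is divisible by every power
  of two, so the set it cuts out is empty.\<close>

lemma one_in_nash_filtration: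
  assumes "real_variety X"
  shows "\<one>\<^bsub>chain_group X k\<^esub> \<in> nash_filtration X p k"
proof -
  have "nash_constructible X (\<lambda>x. 0)"
    unfolding nash_constructible_def by (intro exI[of _ "[]"]) simp
  then have "\<exists>\<phi> \<psi> S A. (\<forall>x\<in>real_points X. 2 ^ nat (k + p) dvd \<phi> x) \<and>
          nash_constructible X \<psi> \<and>
          semialgebraic X S \<and> sa_dim X S < ereal (real_of_int k) \<and>
          (\<forall>x\<in>real_points X - S. \<phi> x = \<psi> x) \<and>
          A \<in> closed_sets_dim_le X k \<and> \<one>\<^bsub>chain_group X k\<^esub> = chain_of X k A \<and>
          sa_dim X (sym_diff A {x \<in> real_points X. \<not> 2 ^ nat (k + p + 1) dvd \<phi> x})
            < ereal (real_of_int k)"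
    using assms
    \<comment> \<open>Each instance is used twice: the zero function for \<phi> and \<psi>, the
      empty set for \<open>S\<close> and \<open>A\<close>.\<close>
    by (intro exI[of _ "\<lambda>x. 0"] exI[of _ "{}"])
      (simp add: semialgebraic_empty sa_dim_empty empty_in_closed_sets_dim_le chain_of_empty)
  then show ?thesis
    by (simp add: nash_filtration_def chain_group_one_closed)
qed

lemma nash_filtration_subset: "nash_filtration X p k \<subseteq> carrier (chain_group X k)"
  by (auto simp: nash_filtration_def chain_group_one_closed)

lemma nash_filtration_below: "p < - k \<Longrightarrow> nash_filtration X p k = {\<one>\<^bsub>chain_group X k\<^esub>}"
  by (simp add: nash_filtration_def)

section \<open>Complexes whose lowest filtration step sits in the top degree\<close>

lemma is_gmodule_m_closed:
  "is_gmodule G A \<Longrightarrow> x \<in> carrier A \<Longrightarrow> y \<in> carrier A \<Longrightarrow> x \<otimes>\<^bsub>A\<^esub> y \<in> carrier A"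
  by (auto simp: is_gmodule_def comm_group_def comm_monoid_def intro: monoid.m_closed)

lemma is_gmodule_act_closed:
  "is_gmodule G A \<Longrightarrow> g \<in> carrier G \<Longrightarrow> x \<in> carrier A \<Longrightarrow> act A g x \<in> carrier A"
  by (auto simp: is_gmodule_def hom_def)

text \<open>
  The values of \<open>diff K\<close> are not assumed to be chains; \<open>diff_r_one\<close> makes up for the missing unit law.
\<close>

locale top_degree_complex =
  fixes K :: "('g, 'm) filtered_gcomplex" and d :: int
  assumes m_closed: "x \<in> carrier (grp K q) \<Longrightarrow> y \<in> carrier (grp K q) \<Longrightarrow>
      x \<otimes>\<^bsub>grp K q\<^esub> y \<in> carrier (grp K q)"
    and one_closed: "\<one>\<^bsub>grp K q\<^esub> \<in> carrier (grp K q)"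
    and l_one: "x \<in> carrier (grp K q) \<Longrightarrow> \<one>\<^bsub>grp K q\<^esub> \<otimes>\<^bsub>grp K q\<^esub> x = x"
    and diff_r_one: "diff K q x \<otimes>\<^bsub>grp K (q - 1)\<^esub> \<one>\<^bsub>grp K (q - 1)\<^esub> = diff K q x"
    and diff_one: "diff K q \<one>\<^bsub>grp K q\<^esub> = \<one>\<^bsub>grp K (q - 1)\<^esub>"
    and gact_one: "gact K q g \<one>\<^bsub>grp K q\<^esub> = \<one>\<^bsub>grp K q\<^esub>"
    and filt_subset: "filt K p q \<subseteq> carrier (grp K q)"
    and one_in_filt: "\<one>\<^bsub>grp K q\<^esub> \<in> filt K p q"
    and filt_below: "p < - q \<Longrightarrow> filt K p q = {\<one>\<^bsub>grp K q\<^esub>}"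
    and carrier_above: "d < q \<Longrightarrow> carrier (grp K q) = {\<one>\<^bsub>grp K q\<^esub>}"
begin

lemma filt_above: "d < q \<Longrightarrow> filt K p q = {\<one>\<^bsub>grp K q\<^esub>}"
  using filt_subset[of p q] one_in_filt[of q p] carrier_above[of q] by auto

text \<open>The cycle condition is the one in \<open>page_cycles K 1\<close>: the differential has
  to land in step -d - 1 of degree d - 1, which is trivial.\<close>

definition top_cycles :: "'m set" where
  "top_cycles = {x \<in> filt K (- d) d. diff K d x = \<one>\<^bsub>grp K (d - 1)\<^esub>}"

lemma top_cycles_subset: "top_cycles \<subseteq> carrier (grp K d)"
  using filt_subset by (auto simp: top_cycles_def)

lemma page_cycles_top: "page_cycles K 1 (- d) (2 * d) = top_cycles"
  by (simp add: page_cycles_def top_cycles_def filt_below)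

text \<open>Both factors vanish: step -d - 1 is trivial in degree d, and the boundaries come from
  degree d + 1, where only the zero chain exists.\<close>

lemma page_boundaries_top: "page_boundaries K 1 (- d) (2 * d) = {\<one>\<^bsub>grp K d\<^esub>}"
proof -
  have "page_cycles K 0 (- d - 1) (2 * d + 1) = {\<one>\<^bsub>grp K d\<^esub>}"
    by (auto simp: page_cycles_def filt_below diff_one)
  moreover have "page_cycles K 0 (- d) (2 * d + 1) = {\<one>\<^bsub>grp K (d + 1)\<^esub>}"
    using diff_one[of "d + 1"] by (auto simp: page_cycles_def filt_above one_in_filt add.commute)
  ultimately show ?thesis
    using diff_one[of "d + 1"]
    by (simp add: page_boundaries_def set_mult_def l_one one_closed add.commute)
qed

lemma page_class_top:
  "x \<in> carrier (grp K d) \<Longrightarrow> page_class K 1 (- d) (2 * d) x = {x}"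
  by (simp add: page_class_def page_boundaries_top r_coset_def l_one)

lemma page_module_top:
  "carrier (page_module K 1 (- d) (2 * d)) = (\<lambda>x. {x}) ` top_cycles"
  "C \<otimes>\<^bsub>page_module K 1 (- d) (2 * d)\<^esub> D = C <#>\<^bsub>grp K d\<^esub> D"
  "\<one>\<^bsub>page_module K 1 (- d) (2 * d)\<^esub> = {\<one>\<^bsub>grp K d\<^esub>}"
  "act (page_module K 1 (- d) (2 * d)) g C = gact K d g ` C"
proof -
  have "carrier (page K 1 (- d) (2 * d)) = (\<lambda>x. {x}) ` top_cycles"
    using l_one top_cycles_subset
    by (auto simp: page_def FactGroup_def RCOSETS_def page_cycles_top page_boundaries_top r_coset_def
        image_iff subset_iff)
  then show "carrier (page_module K 1 (- d) (2 * d)) = (\<lambda>x. {x}) ` top_cycles"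
    by (simp add: page_module_def)
  show "C \<otimes>\<^bsub>page_module K 1 (- d) (2 * d)\<^esub> D = C <#>\<^bsub>grp K d\<^esub> D"
    by (simp add: page_module_def page_def FactGroup_def set_mult_def)
  show "\<one>\<^bsub>page_module K 1 (- d) (2 * d)\<^esub> = {\<one>\<^bsub>grp K d\<^esub>}"
    by (simp add: page_module_def page_def FactGroup_def page_boundaries_top)
  show "act (page_module K 1 (- d) (2 * d)) g C = gact K d g ` C"
    by (simp add: page_module_def)
qed

text \<open>\<open>S\<close> is a bare set of values, so \<open>top_cycles\<close> and
  \<open>filt K (- d) d\<close> can both be used without being made into modules.\<close>

definition cochains ::
    "('g, 'e) monoid_scheme \<Rightarrow> ('g, 'a) gmodule \<Rightarrow> 'm set \<Rightarrow> ('a \<Rightarrow> 'm) set" where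
  "cochains G A S = {f \<in> ghom G A (degree_module K d). f ` carrier A \<subseteq> S}"

definition singletons :: "('g, 'a) gmodule \<Rightarrow> ('a \<Rightarrow> 'm) \<Rightarrow> ('a \<Rightarrow> 'm set)" where
  "singletons A f = (\<lambda>x\<in>carrier A. {f x})"

lemma inj_on_singletons: "inj_on (singletons A) (extensional (carrier A))"
proof (rule inj_onI)
  fix f g assume fg: "f \<in> extensional (carrier A)" "g \<in> extensional (carrier A)"
    and eq: "singletons A f = singletons A g"
  have "f x = g x" if "x \<in> carrier A" for x
    using that fun_cong[OF eq, of x] by (simp add: singletons_def)
  with fg show "f = g" by (rule extensionalityI)
qed

text \<open>The page is a copy of \<open>top_cycles\<close> wrapped into singletons, with
  elementwise product and action. A function into it unwraps uniquely, and additivity and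
  equivariance unwrap with it.\<close>

lemma ghom_page_module_top:
  assumes "is_gmodule G A"
  shows "ghom G A (page_module K 1 (- d) (2 * d)) = singletons A ` cochains G A top_cycles"
proof -
  note mult = is_gmodule_m_closed[OF assms] and act = is_gmodule_act_closed[OF assms]
  have iff: "singletons A f \<in> ghom G A (page_module K 1 (- d) (2 * d)) \<longleftrightarrow> f \<in> cochains G A top_cycles"
    if "f \<in> extensional (carrier A)" for f
    using that top_cycles_subset mult act
    by (auto simp: ghom_def hom_def cochains_def singletons_def page_module_top degree_module_def
        set_mult_def image_subset_iff Pi_iff subset_iff)
  have "F \<in> singletons A ` extensional (carrier A)"
    if F: "F \<in> ghom G A (page_module K 1 (- d) (2 * d))" for F
  proof (rule image_eqI)
    have "F x \<in> (\<lambda>x. {x}) ` top_cycles" if "x \<in> carrier A" for x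
      using F that by (auto simp: ghom_def hom_def page_module_top)
    then have "F x = {the_elem (F x)}" if "x \<in> carrier A" for x
      using that by fastforce
    moreover have "F \<in> extensional (carrier A)" using F by (simp add: ghom_def)
    ultimately show "F = singletons A (\<lambda>x\<in>carrier A. the_elem (F x))"
      by (intro extensionalityI[where A = "carrier A"]) (auto simp: singletons_def)
  qed simp
  moreover have "cochains G A top_cycles \<subseteq> extensional (carrier A)"
    by (auto simp: cochains_def ghom_def)
  ultimately show ?thesis
    using iff by blast
qed

lemma ghom_const_one:
  assumes "is_gmodule G A"
  shows "(\<lambda>x\<in>carrier A. \<one>\<^bsub>grp K q\<^esub>) \<in> ghom G A (degree_module K q)"
  by (auto simp: ghom_def hom_def degree_module_def one_closed l_one gact_one
      is_gmodule_m_closed[OF assms] is_gmodule_act_closed[OF assms])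

end

section \<open>Cochains on the resolution and the filtered complex \<open>L\<close>\<close>

locale top_degree_cochains = top_degree_complex K d
  for K :: "('g, 'm) filtered_gcomplex" and d +
  fixes G :: "('g, 'e) monoid_scheme" and F :: "('g, 'f) resolution"
  assumes gmodule: "is_gmodule G (res_mod F n)"
    and bd: "res_bd F n \<in> ghom G (res_mod F (Suc n)) (res_mod F n)"
begin

abbreviation M where "M \<equiv> page_module K 1 (- d) (2 * d)"
abbreviation L where "L \<equiv> L_complex G F K"

lemma bd_closed: "x \<in> carrier (res_mod F (Suc n)) \<Longrightarrow> res_bd F n x \<in> carrier (res_mod F n)"
  using bd[of n] by (auto simp: ghom_def hom_def)

lemma codiff_cochains:
  assumes "f \<in> cochains G (res_mod F n) S"
  shows "codiff F n f \<in> cochains G (res_mod F (Suc n)) S"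
  using assms bd[of n] is_gmodule_m_closed[OF gmodule] is_gmodule_act_closed[OF gmodule]
    bd_closed
  by (auto simp: cochains_def ghom_def hom_def codiff_def image_subset_iff Pi_iff)

text \<open>\<open>codiff\<close> acts on arguments and \<open>singletons\<close> on values, so they
  commute.\<close>

lemma codiff_singletons:
  "codiff F n (singletons (res_mod F n) f) = singletons (res_mod F (Suc n)) (codiff F n f)"
  unfolding codiff_def singletons_def by (rule restrict_ext) (simp add: bd_closed)

definition top_cocycles :: "nat \<Rightarrow> ('f \<Rightarrow> 'm) set" where
  "top_cocycles n = {f \<in> cochains G (res_mod F n) top_cycles.
     codiff F n f = (\<lambda>x\<in>carrier (res_mod F (Suc n)). \<one>\<^bsub>grp K d\<^esub>)}"

definition top_coboundaries :: "nat \<Rightarrow> ('f \<Rightarrow> 'm) set" where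
  "top_coboundaries n = (case n of
       0 \<Rightarrow> {\<lambda>x\<in>carrier (res_mod F 0). \<one>\<^bsub>grp K d\<^esub>}
     | Suc m \<Rightarrow> codiff F m ` cochains G (res_mod F m) top_cycles)"

lemma cocycles_M: "cocycles G F n M = singletons (res_mod F n) ` top_cocycles n"
proof -
  have "codiff F n (singletons (res_mod F n) f) = (\<lambda>x\<in>carrier (res_mod F (Suc n)). \<one>\<^bsub>M\<^esub>) \<longleftrightarrow>
      codiff F n f = (\<lambda>x\<in>carrier (res_mod F (Suc n)). \<one>\<^bsub>grp K d\<^esub>)" for f
    unfolding codiff_singletons page_module_top
    by (auto simp: singletons_def codiff_def fun_eq_iff restrict_def)
  then show ?thesis
    unfolding cocycles_def top_cocycles_def ghom_page_module_top[OF gmodule] by blast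
qed

lemma coboundaries_M: "coboundaries G F n M = singletons (res_mod F n) ` top_coboundaries n"
proof (cases n)
  case 0
  then show ?thesis
    by (simp add: coboundaries_def top_coboundaries_def page_module_top singletons_def
        restrict_def fun_eq_iff)
next
  case (Suc m)
  then show ?thesis
    by (simp add: coboundaries_def top_coboundaries_def ghom_page_module_top[OF gmodule] image_image
        codiff_singletons)
qed

lemma one_L: "\<one>\<^bsub>total_group G F K k\<^esub> =
    (\<lambda>q\<in>{k..}. \<lambda>x\<in>carrier (res_mod F (nat (q - k))). \<one>\<^bsub>grp K q\<^esub>)"
  by (simp add: total_group_def ghom_group_def degree_module_def)

lemma filt_L: "u \<in> filt L a k \<longleftrightarrow> u \<in> extensional {k..} \<and>
    (\<forall>q\<ge>k. u q \<in> ghom G (res_mod F (nat (q - k))) (degree_module K q) \<and>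
       u q ` carrier (res_mod F (nat (q - k))) \<subseteq> filt K a q)"
  by (auto simp: L_complex_def total_group_def ghom_group_def PiE_iff image_subset_iff)

lemma ghom_eq_one:
  assumes "f \<in> ghom G A N" "f ` carrier A \<subseteq> {c}"
  shows "f = (\<lambda>x\<in>carrier A. c)"
  using assms by (intro extensionalityI[where A = "carrier A"]) (auto simp: ghom_def)

lemma one_in_filt_L: "\<one>\<^bsub>total_group G F K k\<^esub> \<in> filt L a k"
  unfolding filt_L one_L using gmodule by (auto simp: ghom_const_one one_in_filt)

lemma filt_L_trivial:
  assumes "\<And>q. k \<le> q \<Longrightarrow> filt K a q = {\<one>\<^bsub>grp K q\<^esub>}"
  shows "filt L a k = {\<one>\<^bsub>total_group G F K k\<^esub>}"
proof -
  have "u = \<one>\<^bsub>total_group G F K k\<^esub>" if u: "u \<in> filt L a k" for u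
    unfolding one_L
  proof (rule extensionalityI[where A = "{k..}"])
    fix q assume "q \<in> {k..}"
    then show "u q = (\<lambda>q\<in>{k..}. \<lambda>x\<in>carrier (res_mod F (nat (q - k))). \<one>\<^bsub>grp K q\<^esub>) q"
      using u assms[of q] by (auto simp: filt_L intro!: ghom_eq_one)
  qed (use u in \<open>auto simp: filt_L\<close>)
  then show ?thesis
    using one_in_filt_L by blast
qed

text \<open>For q \<le> d the index -d - 1 lies below -q, and for q > d there are no nonzero
  chains.\<close>

lemma filt_L_below: "filt L (- d - 1) k = {\<one>\<^bsub>total_group G F K k\<^esub>}"
proof (rule filt_L_trivial)
  fix q show "filt K (- d - 1) q = {\<one>\<^bsub>grp K q\<^esub>}"
    by (cases "d < q") (simp_all add: filt_above filt_below)
qed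

lemma filt_L_above: "d < k \<Longrightarrow> filt L a k = {\<one>\<^bsub>total_group G F K k\<^esub>}"
  by (rule filt_L_trivial) (simp add: filt_above)

text \<open>With index -d the same two cases leave exactly the component q = d, which is present
  because k \<le> d.\<close>

lemma filt_L_top:
  assumes "k \<le> d"
  shows "filt L (- d) k =
    single_degree F K k d ` cochains G (res_mod F (nat (d - k))) (filt K (- d) d)"
proof (intro equalityI subsetI)
  fix u assume u: "u \<in> filt L (- d) k"
  have "u = single_degree F K k d (u d)"
    unfolding single_degree_def
  proof (rule extensionalityI[where A = "{k..}"])
    fix q assume q: "q \<in> {k..}"
    show "u q = (\<lambda>q\<in>{k..}. if q = d then u d else
        (\<lambda>x\<in>carrier (res_mod F (nat (q - k))). \<one>\<^bsub>grp K q\<^esub>)) q"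
    proof (cases "q = d")
      case False
      then have "filt K (- d) q = {\<one>\<^bsub>grp K q\<^esub>}"
        by (cases "d < q") (simp_all add: filt_above filt_below)
      then show ?thesis
        using u q False by (auto simp: filt_L intro!: ghom_eq_one)
    qed (use q in auto)
  qed (use u in \<open>auto simp: filt_L\<close>)
  moreover have "u d \<in> cochains G (res_mod F (nat (d - k))) (filt K (- d) d)"
    using u assms by (simp add: filt_L cochains_def)
  ultimately show "u \<in> single_degree F K k d ` cochains G (res_mod F (nat (d - k))) (filt K (- d) d)"
    by blast
next
  fix u assume "u \<in> single_degree F K k d ` cochains G (res_mod F (nat (d - k))) (filt K (- d) d)"
  then show "u \<in> filt L (- d) k"
    using assms gmodule
    by (auto simp: filt_L single_degree_def cochains_def image_subset_iff ghom_const_one one_in_filt)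
qed

text \<open>In degree k - 1 of \<open>L\<close>, the component of chain degree q is defined on the
  module of the resolution one step above the one used in degree k.\<close>

lemma nat_diff_pred: "k \<le> q \<Longrightarrow> nat (q - (k - 1)) = Suc (nat (q - k))" for k q :: int
  by simp

lemma total_diff_one:
  "total_diff F K k \<one>\<^bsub>total_group G F K k\<^esub> = \<one>\<^bsub>total_group G F K (k - 1)\<^esub>"
  unfolding one_L total_diff_def
proof (intro restrict_ext)
  fix q x assume q: "q \<in> {k - 1..}" and x: "x \<in> carrier (res_mod F (nat (q - (k - 1))))"
  have 1: "diff K (q + 1) \<one>\<^bsub>grp K (q + 1)\<^esub> = \<one>\<^bsub>grp K q\<^esub>"
    using diff_one[of "q + 1"] by simp
  have 2: "nat (q + 1 - k) = nat (q - (k - 1))" by simp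
  show "(if k \<le> q then diff K (q + 1) ((\<lambda>q\<in>{k..}. \<lambda>x\<in>carrier (res_mod F (nat (q - k))). \<one>\<^bsub>grp K q\<^esub>) (q + 1) x)
      \<otimes>\<^bsub>grp K q\<^esub> codiff F (nat (q - k)) ((\<lambda>q\<in>{k..}. \<lambda>x\<in>carrier (res_mod F (nat (q - k))). \<one>\<^bsub>grp K q\<^esub>) q) x
      else diff K (q + 1) ((\<lambda>q\<in>{k..}. \<lambda>x\<in>carrier (res_mod F (nat (q - k))). \<one>\<^bsub>grp K q\<^esub>) (q + 1) x)) =
      \<one>\<^bsub>grp K q\<^esub>"
  proof (cases "k \<le> q")
    case True
    then have "x \<in> carrier (res_mod F (Suc (nat (q - k))))"
      using x by (simp only: nat_diff_pred)
    then show ?thesis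
      using True x q 1 by (simp add: 2 codiff_def bd_closed l_one one_closed)
  qed (use x q 1 in \<open>simp add: 2\<close>)
qed

text \<open>A component in degree d contributes twice: precomposed, to degree d, and through
  \<open>diff\<close>, to degree d - 1. Everywhere else only units are combined.\<close>

lemma total_diff_single:
  assumes "k \<le> d" and f: "f \<in> carrier (res_mod F (nat (d - k))) \<rightarrow> carrier (grp K d)"
    and q: "k - 1 \<le> q" and x: "x \<in> carrier (res_mod F (nat (q - (k - 1))))"
  shows "total_diff F K k (single_degree F K k d f) q x =
    (if q = d then codiff F (nat (d - k)) f x else if q = d - 1 then diff K d (f x) else \<one>\<^bsub>grp K q\<^esub>)"
proof -
  have diff1: "diff K (q + 1) \<one>\<^bsub>grp K (q + 1)\<^esub> = \<one>\<^bsub>grp K q\<^esub>" for q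
    using diff_one[of "q + 1"] by simp
  have idx: "nat (q + 1 - k) = nat (q - (k - 1))" by simp
  have x': "x \<in> carrier (res_mod F (Suc (nat (q - k))))" if "k \<le> q"
    using that x by (simp only: nat_diff_pred)
  \<comment> \<open>In degree d - 1 a value of \<open>diff\<close> meets the unit coming from
    \<open>codiff\<close> on its right, and that value is not known to lie in the carrier.\<close>
  have r: "diff K d y \<otimes>\<^bsub>grp K (d - 1)\<^esub> \<one>\<^bsub>grp K (d - 1)\<^esub> = diff K d y" for y
    by (rule diff_r_one)
  consider "q = d" | "q = d - 1" | "q \<noteq> d" "q \<noteq> d - 1" by blast
  then show ?thesis
  proof cases
    case 1
    then have "codiff F (nat (d - k)) f x \<in> carrier (grp K d)"
      using x' assms(1) f by (auto simp: codiff_def bd_closed)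
    then show ?thesis
      using 1 q x assms(1) diff1 idx
      by (simp add: total_diff_def single_degree_def l_one)
  next
    case 2
    then show ?thesis
      using q x x' r assms(1) by (auto simp: total_diff_def single_degree_def codiff_def bd_closed)
  next
    case 3
    then show ?thesis
      using q x x' assms(1) diff1
      by (auto simp: total_diff_def single_degree_def idx codiff_def bd_closed l_one one_closed)
  qed
qed


lemma single_degree_one:
  "single_degree F K k d (\<lambda>x\<in>carrier (res_mod F (nat (d - k))). \<one>\<^bsub>grp K d\<^esub>) =
    \<one>\<^bsub>total_group G F K k\<^esub>"
  unfolding single_degree_def one_L by (rule restrict_ext) auto

lemma cochains_funcset:
  "f \<in> cochains G A S \<Longrightarrow> S \<subseteq> carrier (grp K d) \<Longrightarrow> f \<in> carrier A \<rightarrow>\<^sub>E carrier (grp K d)"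
  by (auto simp: cochains_def ghom_def PiE_iff)

lemma cochains_top_cycles:
  "cochains G A top_cycles =
    {f \<in> cochains G A (filt K (- d) d). \<forall>x\<in>carrier A. diff K d (f x) = \<one>\<^bsub>grp K (d - 1)\<^esub>}"
  by (auto simp: cochains_def top_cycles_def)

text \<open>On cycles the contribution in degree d - 1 is trivial, so the total differential is the
  cochain differential, padded again.\<close>

lemma total_diff_top_cycles:
  assumes "k \<le> d" and f: "f \<in> cochains G (res_mod F (nat (d - k))) top_cycles"
  shows "total_diff F K k (single_degree F K k d f) =
    single_degree F K (k - 1) d (codiff F (nat (d - k)) f)"
proof (rule extensionalityI[where A = "{k - 1..}"])
  fix q assume q: "q \<in> {k - 1..}"
  show "total_diff F K k (single_degree F K k d f) q =
    single_degree F K (k - 1) d (codiff F (nat (d - k)) f) q"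
  proof (rule extensionalityI[where A = "carrier (res_mod F (nat (q - (k - 1))))"])
    fix x assume x: "x \<in> carrier (res_mod F (nat (q - (k - 1))))"
    have "f \<in> carrier (res_mod F (nat (d - k))) \<rightarrow> carrier (grp K d)"
      using cochains_funcset[OF f top_cycles_subset] by auto
    note eq = total_diff_single[OF assms(1) this _ x]
    have "diff K d (f x) = \<one>\<^bsub>grp K (d - 1)\<^esub>" if "q = d - 1"
      using f x that by (simp add: cochains_top_cycles)
    then show "total_diff F K k (single_degree F K k d f) q x =
        single_degree F K (k - 1) d (codiff F (nat (d - k)) f) q x"
      using q x by (subst eq) (auto simp: single_degree_def)
  next
    show "single_degree F K (k - 1) d (codiff F (nat (d - k)) f) q
        \<in> extensional (carrier (res_mod F (nat (q - (k - 1)))))"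
      using q assms(1) by (auto simp: single_degree_def codiff_def nat_diff_pred)
  qed (use q in \<open>simp add: total_diff_def\<close>)
qed (simp_all add: total_diff_def single_degree_def)

lemma single_degree_eq_one:
  assumes "k \<le> d"
    and "single_degree F K k d f = \<one>\<^bsub>total_group G F K k\<^esub>"
  shows "f = (\<lambda>x\<in>carrier (res_mod F (nat (d - k))). \<one>\<^bsub>grp K d\<^esub>)"
  using assms(1) fun_cong[OF assms(2), of d] by (simp add: single_degree_def one_L)

text \<open>Step -d - 1 being trivial, the condition says that the total differential is zero. Its
  component in degree d - 1 puts the values into \<open>top_cycles\<close>; the component in degree
  d is then the cocycle condition.\<close>

lemma page_cycles_L:
  assumes "k \<le> d"
  shows "{u \<in> filt L (- d) k. diff L k u \<in> filt L (- d - 1) (k - 1)} =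
    single_degree F K k d ` top_cocycles (nat (d - k))"
proof -
  let ?n = "nat (d - k)"
  have "diff L k (single_degree F K k d f) \<in> filt L (- d - 1) (k - 1) \<longleftrightarrow> f \<in> top_cocycles ?n"
    if f: "f \<in> cochains G (res_mod F ?n) (filt K (- d) d)" for f
  proof
    assume "diff L k (single_degree F K k d f) \<in> filt L (- d - 1) (k - 1)"
    then have eq: "total_diff F K k (single_degree F K k d f) = \<one>\<^bsub>total_group G F K (k - 1)\<^esub>"
      by (simp only: filt_L_below) (simp add: L_complex_def)
    have ff: "f \<in> carrier (res_mod F ?n) \<rightarrow> carrier (grp K d)"
      using cochains_funcset[OF f filt_subset] by auto
    have "diff K d (f x) = \<one>\<^bsub>grp K (d - 1)\<^esub>" if "x \<in> carrier (res_mod F ?n)" for x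
      using total_diff_single[OF assms ff, of "d - 1" x] that assms unfolding eq one_L by simp
    then have c: "f \<in> cochains G (res_mod F ?n) top_cycles"
      using f by (simp add: cochains_top_cycles)
    have "single_degree F K (k - 1) d (codiff F ?n f) = \<one>\<^bsub>total_group G F K (k - 1)\<^esub>"
      using total_diff_top_cycles[OF assms c] eq by simp
    from single_degree_eq_one[OF _ this]
    have "codiff F ?n f = (\<lambda>x\<in>carrier (res_mod F (Suc ?n)). \<one>\<^bsub>grp K d\<^esub>)"
      using assms by (simp only: nat_diff_pred)
    with c show "f \<in> top_cocycles ?n"
      by (simp add: top_cocycles_def)
  next
    assume "f \<in> top_cocycles ?n"
    then have "total_diff F K k (single_degree F K k d f) = \<one>\<^bsub>total_group G F K (k - 1)\<^esub>"
      using assms single_degree_one[of "k - 1"]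
      by (simp only: top_cocycles_def mem_Collect_eq total_diff_top_cycles nat_diff_pred)
    then have "diff L k (single_degree F K k d f) = \<one>\<^bsub>total_group G F K (k - 1)\<^esub>"
      by (simp add: L_complex_def)
    then show "diff L k (single_degree F K k d f) \<in> filt L (- d - 1) (k - 1)"
      by (simp only: filt_L_below singleton_iff)
  qed
  moreover have "top_cocycles ?n \<subseteq> cochains G (res_mod F ?n) (filt K (- d) d)"
    by (auto simp: top_cocycles_def cochains_top_cycles)
  ultimately show ?thesis
    unfolding filt_L_top[OF assms] by blast
qed

text \<open>Here the differential only has to stay in step -d. In degree d - 1 that step is already
  trivial, which again forces the values into \<open>top_cycles\<close>.\<close>

lemma boundary_sources_L:
  assumes "k < d"
  shows "{v \<in> filt L (- d) (k + 1). diff L (k + 1) v \<in> filt L (- d) k} =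
    single_degree F K (k + 1) d ` cochains G (res_mod F (nat (d - (k + 1)))) top_cycles"
proof -
  let ?m = "nat (d - (k + 1))"
  have k: "k + 1 \<le> d" "k \<le> d" using assms by auto
  have Suc_m: "nat (d - k) = Suc ?m" using assms by simp
  have "diff L (k + 1) (single_degree F K (k + 1) d f) \<in> filt L (- d) k \<longleftrightarrow>
      f \<in> cochains G (res_mod F ?m) top_cycles"
    if f: "f \<in> cochains G (res_mod F ?m) (filt K (- d) d)" for f
  proof
    assume D: "diff L (k + 1) (single_degree F K (k + 1) d f) \<in> filt L (- d) k"
    have ff: "f \<in> carrier (res_mod F ?m) \<rightarrow> carrier (grp K d)"
      using cochains_funcset[OF f filt_subset] by auto
    have "diff K d (f x) = \<one>\<^bsub>grp K (d - 1)\<^esub>" if x: "x \<in> carrier (res_mod F ?m)" for x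
    proof -
      have x': "x \<in> carrier (res_mod F (nat (d - 1 - (k + 1 - 1))))"
        using x by (simp add: algebra_simps)
      then have "total_diff F K (k + 1) (single_degree F K (k + 1) d f) (d - 1) x \<in> filt K (- d) (d - 1)"
        using D k by (auto simp: filt_L image_subset_iff) (simp add: L_complex_def)
      then show ?thesis
        using total_diff_single[OF k(1) ff _ x'] k by (simp add: filt_below)
    qed
    then show "f \<in> cochains G (res_mod F ?m) top_cycles"
      using f by (simp add: cochains_top_cycles)
  next
    assume c: "f \<in> cochains G (res_mod F ?m) top_cycles"
    have "diff L (k + 1) (single_degree F K (k + 1) d f) = single_degree F K k d (codiff F ?m f)"
      using total_diff_top_cycles[OF k(1) c] by (simp add: L_complex_def)
    moreover have "codiff F ?m f \<in> cochains G (res_mod F (nat (d - k))) (filt K (- d) d)"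
      unfolding Suc_m by (rule codiff_cochains[OF f])
    ultimately show "diff L (k + 1) (single_degree F K (k + 1) d f) \<in> filt L (- d) k"
      by (simp only: filt_L_top[OF k(2)] imageI)
  qed
  moreover have "cochains G (res_mod F ?m) top_cycles \<subseteq> cochains G (res_mod F ?m) (filt K (- d) d)"
    by (auto simp: cochains_top_cycles)
  ultimately show ?thesis
    unfolding filt_L_top[OF k(1)] by blast
qed

text \<open>For k = d the sources lie in degree d + 1 and reduce to the unit, matching the
  convention for coboundaries in degree 0. For k < d the total differential is \<open>codiff\<close>
  on cycle-valued cochains.\<close>

lemma boundaries_L:
  assumes "k \<le> d"
  shows "diff L (k + 1) ` {v \<in> filt L (- d) (k + 1). diff L (k + 1) v \<in> filt L (- d) k} =
    single_degree F K k d ` top_coboundaries (nat (d - k))"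
proof (cases "k = d")
  case True
  have "diff L (k + 1) \<one>\<^bsub>total_group G F K (k + 1)\<^esub> = \<one>\<^bsub>total_group G F K k\<^esub>"
    using total_diff_one[of "k + 1"] by (simp add: L_complex_def)
  moreover have "filt L (- d) (k + 1) = {\<one>\<^bsub>total_group G F K (k + 1)\<^esub>}"
    using True by (intro filt_L_above) simp
  moreover have "single_degree F K k d (\<lambda>x\<in>carrier (res_mod F 0). \<one>\<^bsub>grp K d\<^esub>) =
      \<one>\<^bsub>total_group G F K k\<^esub>"
    using single_degree_one[of k] True by simp
  ultimately show ?thesis
    using True one_in_filt_L by (auto simp: top_coboundaries_def)
next
  case False
  then have k: "k < d" "k + 1 \<le> d" using assms by auto
  have Suc_m: "nat (d - k) = Suc (nat (d - (k + 1)))" using k by simp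
  have "diff L (k + 1) (single_degree F K (k + 1) d f) =
      single_degree F K k d (codiff F (nat (d - (k + 1))) f)"
    if "f \<in> cochains G (res_mod F (nat (d - (k + 1)))) top_cycles" for f
    using total_diff_top_cycles[OF k(2) that] by (simp add: L_complex_def)
  then show ?thesis
    unfolding boundary_sources_L[OF k(1)] Suc_m top_coboundaries_def nat.case image_image
    by (intro image_cong refl)
qed

text \<open>The factor from step -d - 1 is the unit alone. It is kept as a left coset, because the
  unit law \<open>total_l_one\<close> speaks of elements of \<open>filt L\<close> and membership of
  the differentials is a separate argument.\<close>

lemma page_boundaries_L:
  "page_boundaries L 1 (- d) (k + d) =
    \<one>\<^bsub>total_group G F K k\<^esub> <#\<^bsub>total_group G F K k\<^esub>
      diff L (k + 1) ` {v \<in> filt L (- d) (k + 1). diff L (k + 1) v \<in> filt L (- d) k}"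
proof -
  have "page_cycles L 0 (- d - 1) (k + d + 1) = {\<one>\<^bsub>total_group G F K k\<^esub>}"
  proof -
    have "diff L k \<one>\<^bsub>total_group G F K k\<^esub> \<in> filt L (- d - 1) (k - 1)"
      using total_diff_one[of k] by (simp only: filt_L_below) (simp add: L_complex_def)
    then show ?thesis
      by (auto simp: page_cycles_def filt_L_below)
  qed
  then show ?thesis
    by (simp add: page_boundaries_def page_cycles_def set_mult_def l_coset_def L_complex_def add.commute)
qed

lemma single_degree_mult:
  "single_degree F K k d f \<otimes>\<^bsub>total_group G F K k\<^esub> single_degree F K k d g =
    single_degree F K k d (f \<otimes>\<^bsub>ghom_group G (res_mod F (nat (d - k))) (degree_module K d)\<^esub> g)"
  unfolding total_group_def product_group_def single_degree_def
  by (simp add: ghom_group_def degree_module_def)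
    (auto intro!: restrict_ext simp: l_one one_closed ghom_group_def degree_module_def)

lemma total_l_one:
  "u \<in> filt L a k \<Longrightarrow> \<one>\<^bsub>total_group G F K k\<^esub> \<otimes>\<^bsub>total_group G F K k\<^esub> u = u"
proof (rule extensionalityI[where A = "{k..}"])
  fix q assume u: "u \<in> filt L a k" and q: "q \<in> {k..}"
  have "u q \<in> extensional (carrier (res_mod F (nat (q - k))))"
    "u q ` carrier (res_mod F (nat (q - k))) \<subseteq> carrier (grp K q)"
    using u q filt_subset[of a q] unfolding filt_L ghom_def by blast+
  then have "(\<lambda>x\<in>carrier (res_mod F (nat (q - k))). \<one>\<^bsub>grp K q\<^esub> \<otimes>\<^bsub>grp K q\<^esub> u q x) = u q"
    by (intro extensionalityI[where A = "carrier (res_mod F (nat (q - k)))"]) (auto intro: l_one)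
  then show "(\<one>\<^bsub>total_group G F K k\<^esub> \<otimes>\<^bsub>total_group G F K k\<^esub> u) q = u q"
    using q unfolding one_L
    by (simp add: total_group_def ghom_group_def degree_module_def cong: restrict_cong)
qed (auto simp: filt_L total_group_def)

text \<open>This is the case p > 0, with k = p + d: all components have chain degree above d. It
  mirrors the vanishing of cohomology in degree -p.\<close>

lemma page_L_trivial:
  assumes "d < k"
  shows "carrier (page L 1 (- d) (k + d)) = {{\<one>\<^bsub>total_group G F K k\<^esub>}}"
    and "{\<one>\<^bsub>total_group G F K k\<^esub>} \<otimes>\<^bsub>page L 1 (- d) (k + d)\<^esub> {\<one>\<^bsub>total_group G F K k\<^esub>} =
      {\<one>\<^bsub>total_group G F K k\<^esub>}"
proof -
  have diff: "diff L k \<one>\<^bsub>total_group G F K k\<^esub> = \<one>\<^bsub>total_group G F K (k - 1)\<^esub>" for k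
    using total_diff_one by (simp add: L_complex_def)
  have one: "\<one>\<^bsub>total_group G F K k\<^esub> \<otimes>\<^bsub>total_group G F K k\<^esub> \<one>\<^bsub>total_group G F K k\<^esub> =
      \<one>\<^bsub>total_group G F K k\<^esub>"
    by (rule total_l_one[OF one_in_filt_L])
  have grp: "grp L = total_group G F K"
    by (simp add: L_complex_def)
  have cycles: "page_cycles L 1 (- d) (k + d) = {\<one>\<^bsub>total_group G F K k\<^esub>}"
    using assms one_in_filt_L diff[of k] by (auto simp: page_cycles_def filt_L_above)
  have boundaries: "page_boundaries L 1 (- d) (k + d) = {\<one>\<^bsub>total_group G F K k\<^esub>}"
    using assms one_in_filt_L diff[of "k + 1"] one
    by (auto simp: page_boundaries_L filt_L_above l_coset_def)
  show "carrier (page L 1 (- d) (k + d)) = {{\<one>\<^bsub>total_group G F K k\<^esub>}}"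
    by (simp add: page_def FactGroup_def RCOSETS_def cycles boundaries grp r_coset_def one)
  show "{\<one>\<^bsub>total_group G F K k\<^esub>} \<otimes>\<^bsub>page L 1 (- d) (k + d)\<^esub> {\<one>\<^bsub>total_group G F K k\<^esub>} =
      {\<one>\<^bsub>total_group G F K k\<^esub>}"
    by (simp add: page_def FactGroup_def set_mult_def grp one)
qed

section \<open>The isomorphism, and its application to the weight complex\<close>

theorem top_row_iso:
  "\<exists>h \<in> iso (group_cohomology G F (- p) M) (page L 1 (- d) (p + 2 * d)).
     p \<le> 0 \<longrightarrow> (\<forall>f \<in> cocycles G F (nat (- p)) (degree_module K d).
        f ` carrier (res_mod F (nat (- p))) \<subseteq> page_cycles K 1 (- d) (2 * d) \<longrightarrow>
        h (cohomology_class G F (nat (- p)) M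
             (\<lambda>x\<in>carrier (res_mod F (nat (- p))). page_class K 1 (- d) (2 * d) (f x))) =
        page_class L 1 (- d) (p + 2 * d) (single_degree F K (p + d) d f))"
proof (cases "p \<le> 0")
  case False
  \<comment> \<open>Both groups have one element, and the condition on representatives is void for p
    > 0.\<close>
  then have "(\<lambda>_. {\<one>\<^bsub>total_group G F K (p + d)\<^esub>}) \<in>
      iso (group_cohomology G F (- p) M) (page L 1 (- d) (p + d + d))"
    using page_L_trivial[of "p + d"]
    by (simp add: group_cohomology_def iso_def hom_def singleton_group_def bij_betw_def)
  moreover have "p + d + d = p + 2 * d" by simp
  ultimately show ?thesis
    using False by auto
next
  case True
  \<comment> \<open>The total degree of the term in column -d and row p + 2d; the resolution degree
    is then d - k = -p.\<close>
  define k where "k = p + d"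
  define A where "A = res_mod F (nat (- p))"
  \<comment> \<open>The ambient set consists of all functions into the carrier, where closure under
    pointwise products is immediate; for cocycles it would rest on additivity of the
    boundary.\<close>
  define U where "U = carrier A \<rightarrow>\<^sub>E carrier (grp K d)"
  define Z where "Z = top_cocycles (nat (- p))"
  define B where "B = top_coboundaries (nat (- p))"
  define P where "P = ghom_group G A (degree_module K d)"
  define T where "T = single_degree F K k d"
  have k: "k \<le> d" "nat (d - k) = nat (- p)" "p + 2 * d = k + d"
    using True by (simp_all add: k_def)
  have grp: "grp L = total_group G F K"
    by (simp add: L_complex_def)
  have Z: "Z \<subseteq> U"
    using cochains_funcset[OF _ top_cycles_subset] by (auto simp: Z_def U_def A_def top_cocycles_def)
  have B: "B \<subseteq> U"
  proof (cases "nat (- p)")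
    case 0
    then show ?thesis
      by (auto simp: B_def U_def A_def top_coboundaries_def one_closed)
  next
    case (Suc m)
    show ?thesis
    proof
      fix f assume "f \<in> B"
      then have "f \<in> cochains G A top_cycles"
        using Suc codiff_cochains by (auto simp: B_def A_def top_coboundaries_def)
      then show "f \<in> U"
        unfolding U_def by (rule cochains_funcset[OF _ top_cycles_subset])
    qed
  qed
  have cycles: "page_cycles L 1 (- d) (k + d) = T ` Z"
    using page_cycles_L[OF k(1)] by (simp add: page_cycles_def T_def Z_def k(2))
  \<comment> \<open>Reading \<open>boundaries_L\<close> backwards, these elements are differentials
    that were selected for lying in this step; this is what opens the way to
    \<open>total_l_one\<close>.\<close>
  have "T ` B \<subseteq> filt L (- d) k"
    unfolding T_def B_def boundaries_L[OF k(1), unfolded k(2), symmetric] by auto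
  then have boundaries: "page_boundaries L 1 (- d) (k + d) = T ` B"
    unfolding page_boundaries_L boundaries_L[OF k(1)] k(2) T_def[symmetric] B_def[symmetric]
      l_coset_def UNION_singleton_eq_range
    by (subst image_cong[OF refl total_l_one]) (blast, simp)
  have page: "page L 1 (- d) (k + d) = (total_group G F K k)\<lparr>carrier := T ` Z\<rparr> Mod T ` B"
    by (simp add: page_def cycles boundaries grp)
  have coh: "group_cohomology G F (- p) M =
      (ghom_group G A M)\<lparr>carrier := singletons A ` Z\<rparr> Mod singletons A ` B"
    using True by (simp add: group_cohomology_def cocycles_M coboundaries_M A_def Z_def B_def)
  have "\<exists>h \<in> iso ((ghom_group G A M)\<lparr>carrier := singletons A ` Z\<rparr> Mod singletons A ` B)
      ((total_group G F K k)\<lparr>carrier := T ` Z\<rparr> Mod T ` B).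
     \<forall>f\<in>Z. h (singletons A ` B #>\<^bsub>ghom_group G A M\<^esub> singletons A f) =
       T ` B #>\<^bsub>total_group G F K k\<^esub> T f"
  proof (rule FactGroup_iso_of_injections[OF _ _ _ _ _ Z B])
    fix f g assume fg: "f \<in> U" "g \<in> U"
    show "f \<otimes>\<^bsub>P\<^esub> g \<in> U"
      using fg by (auto simp: P_def U_def ghom_group_def degree_module_def PiE_iff intro: m_closed)
    show "singletons A (f \<otimes>\<^bsub>P\<^esub> g) = singletons A f \<otimes>\<^bsub>ghom_group G A M\<^esub> singletons A g"
      unfolding P_def ghom_group_def singletons_def
      by (auto simp: page_module_top degree_module_def set_mult_def intro!: restrict_ext)
    show "T (f \<otimes>\<^bsub>P\<^esub> g) = T f \<otimes>\<^bsub>total_group G F K k\<^esub> T g"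
      by (simp add: T_def P_def A_def single_degree_mult k(2))
  next
    show "inj_on (singletons A) U"
      using inj_on_singletons by (rule inj_on_subset) (auto simp: U_def PiE_iff)
    show "inj_on T U"
    proof (rule inj_onI)
      fix f g assume "T f = T g"
      \<comment> \<open>The function is recovered as the component of degree d, which exists since k
        \<le> d.\<close>
      from fun_cong[OF this, of d] show "f = g"
        using k(1) by (simp add: T_def single_degree_def)
    qed
  qed
  then obtain h where h: "h \<in> iso (group_cohomology G F (- p) M) (page L 1 (- d) (k + d))"
    and hZ: "\<And>f. f \<in> Z \<Longrightarrow> h (singletons A ` B #>\<^bsub>ghom_group G A M\<^esub> singletons A f) =
       T ` B #>\<^bsub>total_group G F K k\<^esub> T f"
    unfolding coh page by blast
  have "h (cohomology_class G F (nat (- p)) M (\<lambda>x\<in>carrier A. page_class K 1 (- d) (2 * d) (f x))) =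
        page_class L 1 (- d) (k + d) (T f)"
    if f: "f \<in> cocycles G F (nat (- p)) (degree_module K d)" "f ` carrier A \<subseteq> top_cycles" for f
  proof -
    have fZ: "f \<in> Z"
      using f by (simp add: Z_def top_cocycles_def cocycles_def cochains_def A_def degree_module_def)
    have "(\<lambda>x\<in>carrier A. page_class K 1 (- d) (2 * d) (f x)) = singletons A f"
      unfolding singletons_def using f(2) top_cycles_subset
      by (intro restrict_ext page_class_top) auto
    then show ?thesis
      using hZ[OF fZ]
      by (simp add: cohomology_class_def page_class_def coboundaries_M boundaries grp A_def B_def)
  qed
  then show ?thesis
    using h unfolding page_cycles_top A_def T_def k(3) k_def[symmetric] by blast
qed

end

lemma top_degree_complex_weight_complex:
  fixes X :: "('p, 's) rspace" and \<alpha> :: "'g \<Rightarrow> ('p, 's, 'p, 's) morphism"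
  assumes "real_variety X" and "krull_dim (zariski X) \<le> ereal (real_of_int d)"
  shows "top_degree_complex (weight_complex X \<alpha>) d"
proof
  fix q assume "d < q"
  then have "krull_dim (zariski X) < ereal (real_of_int q)"
    by (intro le_less_trans[OF assms(2)]) simp
  then show "carrier (grp (weight_complex X \<alpha>) q) = {\<one>\<^bsub>grp (weight_complex X \<alpha>) q\<^esub>}"
    by (simp add: weight_complex_def chain_group_trivial)
\<comment> \<open>\<open>chain_boundary\<close> is unfolded to expose \<open>chain_of\<close>, whose
  unit law gives \<open>diff_r_one\<close>; the rule for the zero chain is unfolded alike so that it
  still matches.\<close>
qed (use assms(1) in \<open>auto simp: weight_complex_def chain_group_closed
    chain_group_one_closed chain_group_l_one chain_boundary_def chain_of_r_one
    chain_boundary_one[unfolded chain_boundary_def] chain_push_one one_in_nash_filtration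
    nash_filtration_below nash_filtration_subset[THEN subsetD]\<close>)

theorem corollary3p19:
  fixes G :: "('g, 'e) monoid_scheme"
    and X :: "('p, 's) rspace"
    and \<alpha> :: "'g \<Rightarrow> ('p, 's, 'p, 's) morphism"
    and F :: "('g, 'f) resolution"
    and d :: nat
  assumes "group G" and "finite (carrier G)"
    and "real_G_variety G X \<alpha>"
    and "krull_dim (zariski X) = ereal (real d)"
    and "projective_resolution G F"
  shows "\<forall>p::int.
    \<exists>h \<in> iso (group_cohomology G F (- p) (weight_page X \<alpha> 2 0 (int d)))
             (equivariant_weight_page G F X \<alpha> 2 p (int d)).
      canonical_map G F X \<alpha> (int d) p h"
proof
  fix p :: int
  let ?K = "weight_complex X \<alpha>"
  interpret top_degree_complex ?K "int d"
    using assms(3,4) by (intro top_degree_complex_weight_complex) (simp_all add: real_G_variety_def)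
  interpret top_degree_cochains ?K "int d" G F
    using assms(5) by unfold_locales (simp_all add: projective_resolution_def projective_gmodule_def)
  show "\<exists>h \<in> iso (group_cohomology G F (- p) (weight_page X \<alpha> 2 0 (int d)))
             (equivariant_weight_page G F X \<alpha> 2 p (int d)).
      canonical_map G F X \<alpha> (int d) p h"
    using top_row_iso[of p]
    by (simp add: canonical_map_def weight_page_def equivariant_weight_page_def weight_class_def
        equivariant_weight_class_def weight_cycles_def equivariant_weight_complex_def reindex_def)
qed

end
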